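(* Let $n\ge 1$ and $r\ge 1$ be integers, and let $\sigma\in S_n$ be a permutation with cycle lengths $\lambda_1,\ldots,\lambda_k$ (fixed points included as cycles of length $1$, so $\lambda_1+\cdots+\lambda_k=n$). Then the value at $\sigma$ of the character of the $S_n$-representation $\mathrm{Pl}(\Delta_r^n)$ (plates in $\Delta_r^n$) is $r^{k-1}$ if $\gcd(\lambda_1,\ldots,\lambda_k,r)=1$, and is $0$ otherwise.
   Context: For $S\subseteq\{1,\ldots,n\}$ write $x_S=\sum_{i\in S}x_i$. For an ordered set partition $(S_1,\ldots,S_k)$ of $\{1,\ldots,n\}$ into nonempty blocks (called lumps) and an ordered partition $s_1+\cdots+s_k=r$ of the positive integer $r$ into positive integers $s_i$ (called positions), the plate $[[(S_1)_{s_1}\cdots(S_k)_{s_k}]]$ is the characteristic function of the set of $x\in\mathbb{R}^n$ with $x_{S_1}\ge s_1$, $x_{S_1}+x_{S_2}\ge s_1+s_2$, ..., $x_{S_1}+\cdots+x_{S_{k-1}}\ge s_1+\cdots+s_{k-1}$, and $x_{S_1}+\cdots+x_{S_k}= s_1+\cdots+s_k=r$. Let $\Delta_r^n=\{x\in[0,r]^n:\sum_{i=1}^n x_i=r\}$. $\mathrm{Pl}(\Delta_r^n)$ denotes the complex-linear span of the plates in $\Delta_r^n$, i.e. of the functions on $\Delta_r^n$ obtained by restricting to $\Delta_r^n$ all plates $[[(S_1)_{s_1}\cdots(S_k)_{s_k}]]$ with $s_1+\cdots+s_k=r$, where functions are identified when they differ only on a finite union of polyhedra of dimension less than $n-1$.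 The symmetric group $S_n$ acts on $\mathrm{Pl}(\Delta_r^n)$ by permuting coordinates, so that $\sigma\cdot[[(S_1)_{s_1}\cdots(S_k)_{s_k}]]=[[(\sigma(S_1))_{s_1}\cdots(\sigma(S_k))_{s_k}]]$. *)

theory Defs
  imports "HOL-Analysis.Analysis" "HOL-Combinatorics.Orbits"
begin

text \<open>
  Coordinates are indexed by a finite type \<open>'n\<close> in place of \<open>{1..n}\<close>; thus \<open>n = CARD('n)\<close> is an
  arbitrary positive integer and the symmetric group consists of the \<open>\<sigma>\<close> with \<open>\<sigma> permutes UNIV\<close>.
\<close>

text \<open>
  Trace of the restriction of \<open>f\<close> to an invariant subspace \<open>V\<close>, computed in a chosen basis.
  For finite-dimensional \<open>V\<close> the choice is irrelevant, see \<open>trace_on_eq\<close> below.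
\<close>

definition (in vector_space) trace_on :: "'b set \<Rightarrow> ('b \<Rightarrow> 'b) \<Rightarrow> 'a" where
  "trace_on V f =
     (let B = (SOME B. independent B \<and> span B = V) in \<Sum>b\<in>B. representation B (f b) b)"

lemma (in vector_space) sum_representation_basis_independent:
  assumes f: "\<And>v w. v \<in> V \<Longrightarrow> w \<in> V \<Longrightarrow> f (v + w) = f v + f w"
    and f': "\<And>c v. v \<in> V \<Longrightarrow> f (scale c v) = scale c (f v)"
    and inv: "f ` V \<subseteq> V"
    and B: "finite B" "independent B" "span B = V"
    and C: "finite C" "independent C" "span C = V"
  shows "(\<Sum>b\<in>B. representation B (f b) b) = (\<Sum>c\<in>C. representation C (f c) c)"
proof -
  have subB: "B \<subseteq> V" and subC: "C \<subseteq> V"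
    using span_superset B(3) C(3) by auto
  have subV: "subspace V"
    using B(3) by (metis subspace_span)
  have f0: "f 0 = 0"
    using f'[of 0 0] subspace_0[OF subV] by simp
  have fsum: "f (\<Sum>i\<in>I. scale (g i) (h i)) = (\<Sum>i\<in>I. scale (g i) (f (h i)))"
    if "finite I" "\<And>i. i \<in> I \<Longrightarrow> h i \<in> V" for I g and h :: "'b \<Rightarrow> 'b"
    using that
  proof (induction I rule: finite_induct)
    case empty
    then show ?case by (simp add: f0)
  next
    case (insert x F)
    have "(\<Sum>i\<in>F. scale (g i) (h i)) \<in> V"
      using insert.prems subV by (intro subspace_sum subspace_scale) auto
    moreover have "scale (g x) (h x) \<in> V"
      using insert.prems subV by (intro subspace_scale) auto
    ultimately show ?case
      using insert by (simp add: f f')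
  qed
  let ?P = "\<lambda>b c. representation C b c" and ?Q = "\<lambda>c b. representation B c b"
  have expC: "(\<Sum>c\<in>C. scale (?P v c) c) = v" if "v \<in> V" for v
    using sum_representation_eq[OF C(2) _ C(1)] that C(3) by auto
  have repsumB: "representation B (\<Sum>i\<in>I. scale (g i) (h i)) b = (\<Sum>i\<in>I. g i * ?Q (h i) b)"
    if "finite I" "\<And>i. i \<in> I \<Longrightarrow> h i \<in> V" for I g b and h :: "'b \<Rightarrow> 'b"
    using that B(1,2) unfolding B(3)[symmetric] by (simp add: representation_sum representation_scale span_scale)
  have repsumC: "representation C (\<Sum>i\<in>I. scale (g i) (h i)) b = (\<Sum>i\<in>I. g i * ?P (h i) b)"
    if "finite I" "\<And>i. i \<in> I \<Longrightarrow> h i \<in> V" for I g b and h :: "'b \<Rightarrow> 'b"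
    using that C(1,2) unfolding C(3)[symmetric] by (simp add: representation_sum representation_scale span_scale)
  have expB: "(\<Sum>b\<in>B. scale (?Q v b) b) = v" if "v \<in> V" for v
    using sum_representation_eq[OF B(2) _ B(1)] that B(3) by auto
  have fV: "f v \<in> V" if "v \<in> V" for v
    using inv that by auto
  have "(\<Sum>b\<in>B. ?Q (f b) b) = (\<Sum>b\<in>B. \<Sum>c\<in>C. ?P b c * ?Q (f c) b)"
  proof (rule sum.cong[OF refl])
    fix b assume "b \<in> B"
    then have bV: "b \<in> V" using subB by auto
    have "f b = f (\<Sum>c\<in>C. scale (?P b c) c)"
      using expC[OF bV] by simp
    also have "\<dots> = (\<Sum>c\<in>C. scale (?P b c) (f c))"
      using C(1) subC by (intro fsum[where h = "\<lambda>c. c"]) auto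
    finally show "?Q (f b) b = (\<Sum>c\<in>C. ?P b c * ?Q (f c) b)"
      using repsumB[OF C(1), of f] fV subC by auto
  qed
  also have "\<dots> = (\<Sum>c\<in>C. \<Sum>b\<in>B. ?Q (f c) b * ?P b c)"
    by (subst sum.swap) (simp add: mult.commute)
  also have "\<dots> = (\<Sum>c\<in>C. ?P (f c) c)"
  proof (rule sum.cong[OF refl])
    fix c assume "c \<in> C"
    then have "f c \<in> V" using subC fV by auto
    then have "?P (f c) c = representation C (\<Sum>b\<in>B. scale (?Q (f c) b) b) c"
      using expB by simp
    also have "\<dots> = (\<Sum>b\<in>B. ?Q (f c) b * ?P b c)"
      using B(1) subB by (intro repsumC[where h = "\<lambda>b. b"]) auto
    finally show "(\<Sum>b\<in>B. ?Q (f c) b * ?P b c) = ?P (f c) c" by simp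
  qed
  finally show ?thesis .
qed

lemma (in vector_space) finite_basis_of_finite_span:
  assumes "finite S" "independent B" "span B = span S"
  shows "finite B"
proof -
  have "B \<subseteq> span S" using span_superset assms(3) by auto
  from independent_span_bound[OF assms(1,2) this] show ?thesis by simp
qed

lemma (in vector_space) trace_on_eq:
  assumes f: "\<And>v w. v \<in> V \<Longrightarrow> w \<in> V \<Longrightarrow> f (v + w) = f v + f w"
    and f': "\<And>c v. v \<in> V \<Longrightarrow> f (scale c v) = scale c (f v)"
    and inv: "f ` V \<subseteq> V"
    and B: "finite B" "independent B" "span B = V"
  shows "trace_on V f = (\<Sum>b\<in>B. representation B (f b) b)"
proof -
  define C where "C = (SOME B. independent B \<and> span B = V)"
  have C: "independent C" "span C = V"
    using someI[of "\<lambda>B. independent B \<and> span B = V" B] B(2,3) unfolding C_def by auto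
  have "finite C"
    using finite_basis_of_finite_span[OF B(1) C(1)] C(2) B(3) by simp
  then show ?thesis
    using sum_representation_basis_independent[OF f f' inv _ C B]
    unfolding trace_on_def C_def[symmetric] by (simp add: Let_def)
qed

definition thin :: "(real ^ 'n) set \<Rightarrow> bool" where
  "thin A \<longleftrightarrow> (\<exists>\<F>. finite \<F> \<and> A \<subseteq> \<Union>\<F> \<and>
     (\<forall>P\<in>\<F>. polyhedron P \<and> aff_dim P < int CARD('n) - 1))"

definition thin_eq :: "(real ^ 'n \<Rightarrow> complex) \<Rightarrow> (real ^ 'n \<Rightarrow> complex) \<Rightarrow> bool" where
  "thin_eq f g \<longleftrightarrow> thin {x. f x \<noteq> g x}"

lemma thin_empty: "thin {}"
  unfolding thin_def by (rule exI[of _ "{}"]) auto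

lemma thin_subset: "thin B \<Longrightarrow> A \<subseteq> B \<Longrightarrow> thin A"
  unfolding thin_def by (meson subset_trans)

lemma thin_Un:
  assumes "thin A" "thin B" shows "thin (A \<union> B)"
proof -
  obtain F G where "finite F" "A \<subseteq> \<Union>F" "\<forall>P\<in>F. polyhedron P \<and> aff_dim P < int CARD('a) - 1"
    and "finite G" "B \<subseteq> \<Union>G" "\<forall>P\<in>G. polyhedron P \<and> aff_dim P < int CARD('a) - 1"
    using assms unfolding thin_def by blast
  then show ?thesis
    unfolding thin_def by (intro exI[of _ "F \<union> G"]) auto
qed

lemma thin_eq_refl: "thin_eq f f"
  unfolding thin_eq_def by (simp add: thin_empty)

lemma thin_eq_sym: "thin_eq f g \<Longrightarrow> thin_eq g f"
  unfolding thin_eq_def by (simp add: eq_commute)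

lemma thin_eq_trans:
  assumes "thin_eq f g" "thin_eq g h" shows "thin_eq f h"
  using thin_Un[OF assms[unfolded thin_eq_def]] unfolding thin_eq_def
  by (rule thin_subset) auto

quotient_type (overloaded) 'n thin_fun = "real ^ 'n::finite \<Rightarrow> complex" / thin_eq
  morphisms rep_thin_fun thin_class
  by (rule equivpI) (auto intro!: reflpI sympI transpI intro: thin_eq_refl thin_eq_sym thin_eq_trans)

instantiation thin_fun :: (finite) ab_group_add
begin

lift_definition zero_thin_fun :: "'a thin_fun" is "\<lambda>_. 0" .

lift_definition plus_thin_fun :: "'a thin_fun \<Rightarrow> 'a thin_fun \<Rightarrow> 'a thin_fun"
  is "\<lambda>f g x. f x + g x"
  unfolding thin_eq_def by (erule thin_subset[OF thin_Un], assumption) auto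

lift_definition uminus_thin_fun :: "'a thin_fun \<Rightarrow> 'a thin_fun" is "\<lambda>f x. - f x"
  unfolding thin_eq_def by simp

lift_definition minus_thin_fun :: "'a thin_fun \<Rightarrow> 'a thin_fun \<Rightarrow> 'a thin_fun"
  is "\<lambda>f g x. f x - g x"
  unfolding thin_eq_def by (erule thin_subset[OF thin_Un], assumption) auto

instance
  by standard (transfer, simp add: thin_eq_refl algebra_simps)+

end

lift_definition scale_thin_fun :: "complex \<Rightarrow> 'n::finite thin_fun \<Rightarrow> 'n thin_fun"
  is "\<lambda>c f x. c * f x"
  unfolding thin_eq_def by (erule thin_subset) auto

interpretation thin_fun: vector_space scale_thin_fun
  by standard (transfer, simp add: thin_eq_refl algebra_simps)+

definition ordered_set_partition :: "'n set list \<Rightarrow> bool" where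
  "ordered_set_partition Ss \<longleftrightarrow> distinct Ss \<and> partition_on UNIV (set Ss)"

definition plate_set :: "'n::finite set list \<Rightarrow> nat list \<Rightarrow> (real ^ 'n) set" where
  "plate_set Ss ss =
     {x. (\<forall>j\<in>{1..<length Ss}. (\<Sum>i<j. \<Sum>a\<in>Ss ! i. x $ a) \<ge> real (\<Sum>i<j. ss ! i)) \<and>
         (\<Sum>i<length Ss. \<Sum>a\<in>Ss ! i. x $ a) = real (\<Sum>i<length Ss. ss ! i)}"

definition plate :: "'n::finite set list \<Rightarrow> nat list \<Rightarrow> real ^ 'n \<Rightarrow> complex" where
  "plate Ss ss = indicator (plate_set Ss ss)"

definition dilated_simplex :: "nat \<Rightarrow> (real ^ 'n::finite) set" where
  "dilated_simplex r = {x. (\<forall>i. x $ i \<in> {0..real r}) \<and> (\<Sum>i\<in>UNIV. x $ i) = real r}"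

text \<open>
  A function on the dilated simplex is represented by its extension by zero. Two functions on
  the simplex differ only on a finite union of low-dimensional polyhedra iff their extensions do,
  so the classes below form a copy of the space of functions on the simplex modulo this relation.
\<close>

definition restrict_to_simplex :: "nat \<Rightarrow> (real ^ 'n::finite \<Rightarrow> complex) \<Rightarrow> real ^ 'n \<Rightarrow> complex" where
  "restrict_to_simplex r f = (\<lambda>x. if x \<in> dilated_simplex r then f x else 0)"

definition plate_classes :: "nat \<Rightarrow> 'n::finite thin_fun set" where
  "plate_classes r = {thin_class (restrict_to_simplex r (plate Ss ss)) | Ss ss.
     ordered_set_partition Ss \<and> length ss = length Ss \<and> (\<forall>s\<in>set ss. 0 < s) \<and> sum_list ss = r}"

definition Pl :: "nat \<Rightarrow> 'n::finite thin_fun set" where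
  "Pl r = thin_fun.span (plate_classes r)"

text \<open>
  The action on functions is \<open>(\<sigma> \<cdot> f) x = f (\<sigma>\<inverse> \<cdot> x)\<close>, where \<open>\<sigma>\<inverse> \<cdot> x\<close> has
  \<open>i\<close>-th coordinate \<open>x $ \<sigma> i\<close>. On plates it is \<open>S\<^sub>i \<mapsto> \<sigma> ` S\<^sub>i\<close>, see \<open>act_plate\<close> below.
  For non-bijective \<open>\<sigma>\<close> it need not respect \<open>thin_eq\<close>, hence the guard in the lifted version.
\<close>

definition act_fun :: "('n::finite \<Rightarrow> 'n) \<Rightarrow> (real ^ 'n \<Rightarrow> complex) \<Rightarrow> real ^ 'n \<Rightarrow> complex" where
  "act_fun \<sigma> f = (\<lambda>x. f (\<chi> i. x $ \<sigma> i))"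

lemma thin_permute_coords:
  fixes \<sigma> :: "'n::finite \<Rightarrow> 'n"
  assumes \<sigma>: "\<sigma> permutes UNIV" and A: "thin A"
  shows "thin {x. (\<chi> i. x $ \<sigma> i) \<in> A}"
proof -
  define h :: "real ^ 'n \<Rightarrow> real ^ 'n" where "h = (\<lambda>x. \<chi> i. x $ inv \<sigma> i)"
  have lin: "linear h"
    unfolding h_def by (rule linearI) (auto simp: vec_eq_iff)
  have hi: "h (\<chi> i. x $ \<sigma> i) = x" for x
    using permutes_inverses[OF \<sigma>] by (simp add: h_def vec_eq_iff)
  have ih: "(\<chi> i. h x $ \<sigma> i) = x" for x
    using permutes_inverses[OF \<sigma>] by (simp add: h_def vec_eq_iff)
  have bij: "bij h"
    by (rule o_bij[of "\<lambda>x. \<chi> i. x $ \<sigma> i"]) (auto simp: fun_eq_iff hi ih)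
  have eq: "{x. (\<chi> i. x $ \<sigma> i) \<in> A} = h ` A"
  proof (intro set_eqI iffI)
    fix x assume "x \<in> {x. (\<chi> i. x $ \<sigma> i) \<in> A}"
    then show "x \<in> h ` A"
      by (intro image_eqI[where x = "\<chi> i. x $ \<sigma> i"]) (simp_all add: hi)
  next
    fix x assume "x \<in> h ` A"
    then show "x \<in> {x. (\<chi> i. x $ \<sigma> i) \<in> A}"
      by (auto simp: ih)
  qed
  obtain F where F: "finite F" "A \<subseteq> \<Union>F" "\<forall>P\<in>F. polyhedron P \<and> aff_dim P < int CARD('n) - 1"
    using A unfolding thin_def by blast
  show ?thesis
    unfolding eq thin_def
    using F lin bij
    by (intro exI[of _ "(`) h ` F"])
       (fastforce simp: polyhedron_linear_image_eq bij_is_inj aff_dim_injective_linear_image)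
qed

lift_definition act :: "('n::finite \<Rightarrow> 'n) \<Rightarrow> 'n thin_fun \<Rightarrow> 'n thin_fun"
  is "\<lambda>\<sigma> f. if \<sigma> permutes UNIV then act_fun \<sigma> f else f"
  using thin_permute_coords by (fastforce simp: thin_eq_def act_fun_def)

definition Pl_character :: "nat \<Rightarrow> ('n::finite \<Rightarrow> 'n) \<Rightarrow> complex" where
  "Pl_character r \<sigma> = thin_fun.trace_on (Pl r) (act \<sigma>)"

text \<open>Multiset of cycle lengths, fixed points included as cycles of length 1.\<close>

definition cycle_lengths :: "('n::finite \<Rightarrow> 'n) \<Rightarrow> nat multiset" where
  "cycle_lengths \<sigma> = image_mset card (mset_set (range (orbit \<sigma>)))"

lemma act_add: "act \<sigma> (v + w) = act \<sigma> v + act \<sigma> w"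
  by transfer (auto simp: act_fun_def thin_eq_refl)

lemma act_scale: "act \<sigma> (scale_thin_fun c v) = scale_thin_fun c (act \<sigma> v)"
  by transfer (auto simp: act_fun_def thin_eq_refl)

lemma act_id: "act id v = v"
  by transfer (auto simp: act_fun_def thin_eq_refl)

lemma act_comp:
  assumes "\<sigma> permutes UNIV" "\<tau> permutes UNIV"
  shows "act (\<sigma> \<circ> \<tau>) v = act \<sigma> (act \<tau> v)"
  using assms by transfer (auto simp: act_fun_def permutes_compose thin_eq_refl)

lemma act_plate:
  fixes \<sigma> :: "'n::finite \<Rightarrow> 'n"
  assumes \<sigma>: "\<sigma> permutes UNIV"
  shows "act_fun \<sigma> (plate Ss ss) = plate (map ((`) \<sigma>) Ss) ss"
proof -
  have "(\<Sum>a\<in>\<sigma> ` S. x $ a) = (\<Sum>a\<in>S. x $ \<sigma> a)" for S and x :: "real ^ 'n"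
    using permutes_inj_on[OF \<sigma>] by (subst sum.reindex) auto
  then show ?thesis
    by (auto simp: act_fun_def plate_def plate_set_def fun_eq_iff indicator_def)
qed

lemma act_fun_restrict:
  fixes \<sigma> :: "'n::finite \<Rightarrow> 'n"
  assumes \<sigma>: "\<sigma> permutes UNIV"
  shows "act_fun \<sigma> (restrict_to_simplex r f) = restrict_to_simplex r (act_fun \<sigma> f)"
proof -
  have "(\<chi> i. x $ \<sigma> i) \<in> dilated_simplex r \<longleftrightarrow> x \<in> dilated_simplex r" for x :: "real ^ 'n"
  proof -
    have "(\<Sum>i\<in>UNIV. x $ \<sigma> i) = (\<Sum>i\<in>UNIV. x $ i)"
      using sum.permute[OF \<sigma>, of "($) x"] by (simp add: o_def)
    moreover have "(\<forall>i. x $ \<sigma> i \<in> {0..real r}) \<longleftrightarrow> (\<forall>i. x $ i \<in> {0..real r})"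
      using permutes_surj[OF \<sigma>] by (metis surjD)
    ultimately show ?thesis
      by (simp add: dilated_simplex_def)
  qed
  then show ?thesis
    by (simp add: act_fun_def restrict_to_simplex_def)
qed

lemma ordered_set_partition_image:
  assumes \<sigma>: "\<sigma> permutes UNIV" and "ordered_set_partition Ss"
  shows "ordered_set_partition (map ((`) \<sigma>) Ss)"
proof -
  have inj: "inj \<sigma>" and surj: "surj \<sigma>"
    using \<sigma> by (auto simp: permutes_inj permutes_surj)
  have "inj ((`) \<sigma>)"
    using inj by (auto simp: inj_on_def inj_image_eq_iff)
  moreover have "partition_on UNIV ((`) \<sigma> ` set Ss)"
  proof (rule partition_onI)
    show "\<Union>((`) \<sigma> ` set Ss) = UNIV"
      using assms(2) surj unfolding ordered_set_partition_def partition_on_def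
      by (metis image_Union)
    show "{} \<notin> (`) \<sigma> ` set Ss"
      using assms(2) unfolding ordered_set_partition_def partition_on_def by auto
    fix p q assume "p \<in> (`) \<sigma> ` set Ss" "q \<in> (`) \<sigma> ` set Ss" "p \<noteq> q"
    then obtain S T where "p = \<sigma> ` S" "q = \<sigma> ` T" "S \<in> set Ss" "T \<in> set Ss" "S \<noteq> T"
      by blast
    moreover from this have "S \<inter> T = {}"
      using assms(2) unfolding ordered_set_partition_def partition_on_def disjoint_def by blast
    ultimately show "disjnt p q"
      using inj by (simp add: disjnt_def image_Int[symmetric])
  qed
  ultimately show ?thesis
    using assms(2) unfolding ordered_set_partition_def
    by (auto simp: distinct_map intro: inj_on_subset)
qed

lemma act_plate_classes:
  fixes \<sigma> :: "'n::finite \<Rightarrow> 'n"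
  assumes \<sigma>: "\<sigma> permutes UNIV" and v: "v \<in> plate_classes r"
  shows "act \<sigma> v \<in> plate_classes r"
proof -
  obtain Ss ss where *: "v = thin_class (restrict_to_simplex r (plate Ss ss))"
    "ordered_set_partition Ss" "length ss = length Ss" "\<forall>s\<in>set ss. 0 < s" "sum_list ss = r"
    using v unfolding plate_classes_def by blast
  have "act \<sigma> v = thin_class (restrict_to_simplex r (plate (map ((`) \<sigma>) Ss) ss))"
    using \<sigma> unfolding *(1) by (simp add: act.abs_eq act_fun_restrict act_plate)
  then show ?thesis
    using *(3-5) ordered_set_partition_image[OF \<sigma> *(2)] unfolding plate_classes_def
    by (intro CollectI exI[of _ "map ((`) \<sigma>) Ss"] exI[of _ ss]) simp
qed

lemma act_Pl:
  assumes \<sigma>: "\<sigma> permutes UNIV"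
  shows "act \<sigma> ` Pl r \<subseteq> Pl r"
proof -
  interpret l: Vector_Spaces.linear scale_thin_fun scale_thin_fun "act \<sigma>"
    by unfold_locales (auto simp: act_add act_scale)
  have "act \<sigma> ` Pl r = thin_fun.span (act \<sigma> ` plate_classes r)"
    unfolding Pl_def by (simp add: l.span_image)
  also have "\<dots> \<subseteq> Pl r"
    unfolding Pl_def using act_plate_classes[OF \<sigma>] by (intro thin_fun.span_mono) auto
  finally show ?thesis .
qed

lemma finite_plate_classes: "finite (plate_classes r :: 'n::finite thin_fun set)"
proof -
  let ?L = "{Ss::'n set list. set Ss \<subseteq> UNIV \<and> distinct Ss}"
  let ?M = "{ss::nat list. set ss \<subseteq> {..r} \<and> length ss \<le> r}"
  have len: "length ss \<le> sum_list ss" if "\<forall>s\<in>set ss. 0 < s" for ss :: "nat list"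
    using that by (induction ss) auto
  have "(plate_classes r :: 'n thin_fun set) \<subseteq> (\<lambda>(Ss, ss). thin_class (restrict_to_simplex r (plate Ss ss))) ` (?L \<times> ?M)"
  proof
    fix v :: "'n thin_fun" assume "v \<in> plate_classes r"
    then obtain Ss ss where *: "v = thin_class (restrict_to_simplex r (plate Ss ss))"
      "ordered_set_partition Ss" "length ss = length Ss" "\<forall>s\<in>set ss. 0 < s" "sum_list ss = r"
      unfolding plate_classes_def by blast
    have "(Ss, ss) \<in> ?L \<times> ?M"
      using * len[of ss] by (auto simp: ordered_set_partition_def member_le_sum_list)
    then show "v \<in> (\<lambda>(Ss, ss). thin_class (restrict_to_simplex r (plate Ss ss))) ` (?L \<times> ?M)"
      by (rule rev_image_eqI) (simp add: *(1))
  qed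
  moreover have "finite ?L"
    by (rule finite_subset_distinct) simp
  moreover have "finite ?M"
    by (rule finite_lists_length_le) simp
  ultimately show ?thesis
    by (meson finite_SigmaI finite_imageI finite_subset)
qed

lemma Pl_character_eq:
  assumes "\<sigma> permutes UNIV" "thin_fun.independent B" "thin_fun.span B = Pl r"
  shows "Pl_character r \<sigma> = (\<Sum>b\<in>B. thin_fun.representation B (act \<sigma> b) b)"
  unfolding Pl_character_def
  using assms thin_fun.finite_basis_of_finite_span[OF finite_plate_classes assms(2)]
  by (intro thin_fun.trace_on_eq) (auto simp: act_add act_scale act_Pl Pl_def[symmetric])

end

theory Submission
  imports Defs "HOL-Number_Theory.Cong"
begin

text \<open>
  Encode a plate by \<open>f\<close>, where \<open>f b < r\<close> is the sum of the positions in front of the lump of \<open>b\<close>.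
  On the simplex the plate says that the walk \<open>t \<mapsto> (\<Sum>b | f b < t. x $ b) - t\<close> is nonnegative.
  Let \<open>e f x = \<zeta> ^ m\<close>, where the walk has its minimum at \<open>m\<close> and \<open>\<zeta>\<close> is a primitive \<open>r\<close>-th root of
  unity; then \<open>e (f + 1 mod r) = \<zeta> * e f\<close> outside a thin set. A Klyachko type
  argument, based on quasi-shuffle products, shows that every plate is a combination of the \<open>e f\<close>;
  it needs only that \<open>\<zeta> ^ s \<noteq> 1\<close> for the partial sums \<open>s\<close> of the positions. Hence the Fourier
  transforms of \<open>e\<close> at the \<open>y \<in> (\<int>/r)\<^sup>n\<close> with \<open>\<Sum>b. y b = 1\<close> span the space, and the other ones
  vanish. They form a basis, because the \<open>r ^ (n - 1)\<close> plates with a given coordinate in the first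
  lump are linearly independent. The group permutes this basis, so the character counts the fixed
  \<open>y\<close>, i.e. the functions \<open>q\<close> on the cycles with \<open>\<Sum>C. card C * q C \<equiv> 1 (mod r)\<close>.
\<close>

section \<open>Roots of unity and linear congruences\<close>

text \<open>The plates with a given coordinate in the first lump are a basis, but in general the
  group does not permute it; it does permute the Fourier family, whose members are not visibly in
  the space. So the two are played against each other: \<open>Pl r\<close> lies in the span of the
  Fourier classes, contains the independent plates, and both families have
  \<open>r ^ (n - 1)\<close> indices, so counting forces equality. Powers of a root of unity are
  used because positions of minima add under quasi-shuffles and powers turn this into products. The
  condition on the sum of \<open>y\<close> is an eigenvalue condition: the shift of the index
  contributes the root itself on one side and its power with exponent the sum of \<open>y\<close> on
  the other. Thin sets matter twice: ties between values of a walk spoil the rotation law on them,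
  and independence must be tested at points that avoid them.\<close>

definition unity_root :: "nat \<Rightarrow> int \<Rightarrow> complex" where
  "unity_root r a = cis (2 * pi * of_int a / of_nat r)"

lemma unity_root_0 [simp]: "unity_root r 0 = 1"
  by (simp add: unity_root_def)

lemma unity_root_add: "unity_root r (a + b) = unity_root r a * unity_root r b"
  by (simp add: unity_root_def cis_mult add_divide_distrib algebra_simps)

lemma unity_root_sum: "unity_root r (\<Sum>i\<in>A. g i) = (\<Prod>i\<in>A. unity_root r (g i))"
  by (induction A rule: infinite_finite_induct) (simp_all add: unity_root_add)

lemma unity_root_mult_nat: "unity_root r (a * int q) = unity_root r a ^ q"
  by (induction q) (simp_all add: unity_root_add distrib_left mult.commute)

lemma unity_root_eq_1_iff:
  assumes "r \<ge> 1"
  shows "unity_root r a = 1 \<longleftrightarrow> int r dvd a"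
proof
  assume "unity_root r a = 1"
  then have "cos (2 * pi * of_int a / of_nat r) = 1"
    unfolding unity_root_def by (metis cis.sel(1) one_complex.sel(1))
  then obtain k where "2 * pi * of_int a / of_nat r = of_int k * 2 * pi"
    by (auto simp: cos_one_2pi_int)
  then have "real_of_int a = of_int (int r * k)"
    using assms by (simp add: field_simps)
  then have "a = int r * k"
    unfolding of_int_eq_iff .
  then show "int r dvd a" by simp
next
  assume "int r dvd a"
  then obtain k where "a = int r * k" ..
  then have "2 * pi * of_int a / of_nat r = 2 * pi * of_int k"
    using assms by simp
  then show "unity_root r a = 1"
    unfolding unity_root_def by (simp only: cis_multiple_2pi Ints_of_int)
qed

lemma unity_root_cong:
  assumes "r \<ge> 1" "int r dvd a - b"
  shows "unity_root r a = unity_root r b"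
  using unity_root_add[of r "a - b" b] unity_root_eq_1_iff[OF assms(1), of "a - b"] assms(2) by simp

lemma sum_unity_root:
  assumes "r \<ge> 1"
  shows "(\<Sum>q<r. unity_root r (a * int q)) = (if int r dvd a then of_nat r else 0)"
proof (cases "int r dvd a")
  case True
  then show ?thesis
    using unity_root_eq_1_iff[OF assms, of a] by (simp add: unity_root_mult_nat)
next
  case False
  then have "unity_root r a \<noteq> 1"
    using unity_root_eq_1_iff[OF assms] by simp
  moreover have "unity_root r a ^ r = 1"
    using unity_root_eq_1_iff[OF assms, of "a * int r"] by (simp add: unity_root_mult_nat)
  ultimately show ?thesis
    using False by (simp add: unity_root_mult_nat geometric_sum)
qed

text \<open>The sum over (Z/r)^A factors into one geometric sum per coordinate. This orthogonality
  relation serves both the count of solutions of a congruence and Fourier inversion.\<close>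

lemma sum_prod_unity_root:
  assumes "r \<ge> 1" "finite A"
  shows "(\<Sum>q\<in>A \<rightarrow>\<^sub>E {..<r}. unity_root r (\<Sum>i\<in>A. c i * int (q i))) =
    (if \<forall>i\<in>A. int r dvd c i then of_nat r ^ card A else 0)"
proof -
  have "(\<Sum>q\<in>A \<rightarrow>\<^sub>E {..<r}. unity_root r (\<Sum>i\<in>A. c i * int (q i))) =
    (\<Sum>q\<in>A \<rightarrow>\<^sub>E {..<r}. \<Prod>i\<in>A. unity_root r (c i * int (q i)))"
    by (simp add: unity_root_sum)
  also have "\<dots> = (\<Prod>i\<in>A. \<Sum>q<r. unity_root r (c i * int q))"
    using assms(2) by (subst prod_sum_PiE) auto
  also have "\<dots> = (\<Prod>i\<in>A. if int r dvd c i then of_nat r else 0)"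
    by (simp add: sum_unity_root[OF assms(1)])
  also have "\<dots> = (if \<forall>i\<in>A. int r dvd c i then of_nat r ^ card A else 0)"
    using assms(2) by (auto simp: prod_zero)
  finally show ?thesis .
qed

text \<open>The congruence is detected by averaging over the characters \<open>m\<close> of Z/r.
  After swapping the sums only those \<open>m\<close> survive for which \<open>r\<close> divides
  every \<open>m * c i\<close>; if the gcd is 1, this leaves \<open>m = 0\<close>. Any other gcd
  divides \<open>r\<close> and the left side, but not 1.\<close>

lemma card_linear_cong_1:
  fixes c :: "'a \<Rightarrow> nat"
  assumes r: "r \<ge> 1" and A: "finite A" "A \<noteq> {}"
  shows "card {q \<in> A \<rightarrow>\<^sub>E {..<r}. [(\<Sum>i\<in>A. c i * q i) = 1] (mod r)} =
    (if Gcd (insert r (c ` A)) = 1 then r ^ (card A - 1) else 0)"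
    (is "card ?Q = _")
proof -
  have fin: "finite (A \<rightarrow>\<^sub>E {..<r})"
    using A by (simp add: finite_PiE)
  have mem: "(of_nat r * (if q \<in> ?Q then 1 else 0) :: complex) =
      (\<Sum>m<r. unity_root r (- int m) * unity_root r (\<Sum>i\<in>A. (int m * int (c i)) * int (q i)))"
    if "q \<in> A \<rightarrow>\<^sub>E {..<r}" for q
  proof -
    let ?d = "int (\<Sum>i\<in>A. c i * q i) - 1"
    have "unity_root r (- int m) * unity_root r (\<Sum>i\<in>A. (int m * int (c i)) * int (q i)) =
        unity_root r (?d * int m)" for m
      unfolding unity_root_add[symmetric]
      by (rule arg_cong[where f = "unity_root r"])
        (simp add: sum_distrib_left algebra_simps flip: sum_distrib_left)
    moreover have "int r dvd ?d \<longleftrightarrow> [(\<Sum>i\<in>A. c i * q i) = 1] (mod r)"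
      by (metis cong_iff_dvd_diff cong_int_iff of_nat_1)
    ultimately show ?thesis
      using that sum_unity_root[OF r, of ?d] by simp
  qed
  have "of_nat r * of_nat (card ?Q) = (\<Sum>q\<in>A \<rightarrow>\<^sub>E {..<r}. of_nat r * (if q \<in> ?Q then 1 else 0) :: complex)"
    using fin by (simp add: sum.If_cases Int_def flip: sum_distrib_left)
  also have "\<dots> = (\<Sum>q\<in>A \<rightarrow>\<^sub>E {..<r}. \<Sum>m<r. unity_root r (- int m) * unity_root r (\<Sum>i\<in>A. (int m * int (c i)) * int (q i)))"
    using mem by (rule sum.cong[OF refl])
  also have "\<dots> = (\<Sum>m<r. unity_root r (- int m) *
      (\<Sum>q\<in>A \<rightarrow>\<^sub>E {..<r}. unity_root r (\<Sum>i\<in>A. (int m * int (c i)) * int (q i))))"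
    by (subst sum.swap) (simp add: sum_distrib_left)
  also have "\<dots> = (\<Sum>m<r. unity_root r (- int m) *
      (if \<forall>i\<in>A. int r dvd int m * int (c i) then of_nat r ^ card A else 0))"
    unfolding sum_prod_unity_root[OF r A(1)] ..
  finally have *: "of_nat r * of_nat (card ?Q) = (\<Sum>m<r. unity_root r (- int m) *
      (if \<forall>i\<in>A. r dvd m * c i then of_nat r ^ card A else 0))"
    by (simp flip: of_nat_mult)
  show ?thesis
  proof (cases "Gcd (insert r (c ` A)) = 1")
    case True
    have "m = 0" if "m < r" "\<forall>i\<in>A. r dvd m * c i" for m
    proof -
      have "r dvd Gcd ((*) m ` insert r (c ` A))"
        using that(2) by (intro Gcd_greatest) auto
      then have "r dvd m"
        unfolding Gcd_mult True by simp
      then show ?thesis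
        using that(1) by (auto dest: dvd_imp_le)
    qed
    then have "(\<Sum>m<r. unity_root r (- int m) * (if \<forall>i\<in>A. r dvd m * c i then of_nat r ^ card A else 0))
        = (\<Sum>m<r. if m = 0 then of_nat r ^ card A else 0 :: complex)"
      by (intro sum.cong) auto
    also have "\<dots> = of_nat r ^ card A"
      using r by simp
    finally have "(of_nat (r * card ?Q) :: complex) = of_nat (r ^ card A)"
      using * by simp
    then have "r * card ?Q = r ^ card A"
      unfolding of_nat_eq_iff .
    also have "\<dots> = r * r ^ (card A - 1)"
      using A card_gt_0_iff[of A] by (cases "card A") auto
    finally show ?thesis
      using r True by simp
  next
    case False
    let ?g = "Gcd (insert r (c ` A))"
    have "?Q = {}"
    proof (rule ccontr)
      assume "?Q \<noteq> {}"
      then obtain q where q: "[(\<Sum>i\<in>A. c i * q i) = 1] (mod r)" by blast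
      have "?g dvd r" by (rule Gcd_dvd) simp
      then have "[(\<Sum>i\<in>A. c i * q i) = 1] (mod ?g)"
        by (rule cong_dvd_modulus_nat[OF q])
      moreover have "?g dvd c i * q i" if "i \<in> A" for i
        by (rule dvd_mult2, rule Gcd_dvd) (use that in simp)
      then have "?g dvd (\<Sum>i\<in>A. c i * q i)"
        by (rule dvd_sum)
      ultimately show False
        using False by (metis cong_dvd_iff nat_dvd_1_iff_1)
    qed
    then show ?thesis
      by (simp only: False card.empty if_False)
  qed
qed

section \<open>Words and quasi-shuffles\<close>

text \<open>A letter is a lump with its position. Plates are encoded without their last letter: on
  the simplex the total is fixed anyway, and the weight drops below \<open>r\<close>, where a
  primitive root has no power equal to 1.\<close>

type_synonym 'n word = "('n set \<times> nat) list"

definition letters :: "'n word \<Rightarrow> 'n set" where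
  "letters w = \<Union>(fst ` set w)"

definition weight :: "'n word \<Rightarrow> nat" where
  "weight w = sum_list (map snd w)"

fun valid_word :: "'n word \<Rightarrow> bool" where
  "valid_word [] \<longleftrightarrow> True"
| "valid_word (l # w) \<longleftrightarrow> 0 < snd l \<and> fst l \<inter> letters w = {} \<and> valid_word w"

definition step :: "real ^ 'n::finite \<Rightarrow> 'n set \<times> nat \<Rightarrow> real" where
  "step x l = (\<Sum>a\<in>fst l. x $ a) - real (snd l)"

definition height :: "real ^ 'n::finite \<Rightarrow> 'n word \<Rightarrow> real" where
  "height x w = sum_list (map (step x) w)"

fun lowest :: "real ^ 'n::finite \<Rightarrow> 'n word \<Rightarrow> real" where
  "lowest x [] = 0"
| "lowest x (l # w) = min 0 (step x l + lowest x w)"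

text \<open>The position is measured in weight and not in letters, so that it becomes a time of
  \<open>walk\<close>. The strict inequality selects the earliest minimum, as \<open>LEAST\<close>
  does in \<open>walk_min\<close>.\<close>

fun lowest_pos :: "real ^ 'n::finite \<Rightarrow> 'n word \<Rightarrow> nat" where
  "lowest_pos x [] = 0"
| "lowest_pos x (l # w) = (if step x l + lowest x w < 0 then snd l + lowest_pos x w else 0)"

lemma letters_simps [simp]:
  "letters [] = {}" "letters (l # w) = fst l \<union> letters w" "letters (u @ v) = letters u \<union> letters v"
  by (auto simp: letters_def)

lemma weight_simps [simp]:
  "weight [] = 0" "weight (l # w) = snd l + weight w" "weight (u @ v) = weight u + weight v"
  by (auto simp: weight_def)

lemma height_simps [simp]:
  "height x [] = 0" "height x (l # w) = step x l + height x w"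
  by (auto simp: height_def)

lemma valid_word_append:
  "valid_word (u @ v) \<longleftrightarrow> valid_word u \<and> valid_word v \<and> letters u \<inter> letters v = {}"
  by (induction u) auto

lemma weight_pos: "valid_word w \<Longrightarrow> w \<noteq> [] \<Longrightarrow> 0 < weight w"
  by (cases w) auto

lemma lowest_le_0: "lowest x w \<le> 0"
  by (cases w) auto

lemma lowest_le_height: "lowest x w \<le> height x w"
  by (induction w) auto

lemma lowest_append: "lowest x (u @ v) = min (lowest x u) (height x u + lowest x v)"
  using lowest_le_0[of x v] by (induction u) (auto simp: min_def algebra_simps)

lemma lowest_pos_eq_0: "lowest x w = 0 \<Longrightarrow> lowest_pos x w = 0"
  by (cases w) auto

lemma le_lowest_iff:
  "c \<le> lowest x w \<longleftrightarrow> (\<forall>j\<le>length w. c \<le> height x (take j w))"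
proof (induction w arbitrary: c)
  case (Cons l w)
  have "c \<le> lowest x (l # w) \<longleftrightarrow> c \<le> 0 \<and> (\<forall>j\<le>length w. c - step x l \<le> height x (take j w))"
    using Cons.IH[of "c - step x l"] by auto
  also have "\<dots> \<longleftrightarrow> (\<forall>j\<le>length (l # w). c \<le> height x (take j (l # w)))"
    (is "?L \<longleftrightarrow> ?R")
  proof
    assume L: ?L
    show ?R
    proof (intro allI impI)
      fix j assume "j \<le> length (l # w)"
      with L show "c \<le> height x (take j (l # w))"
        by (cases j) (auto simp: algebra_simps)
    qed
  next
    assume R: ?R
    have "c - step x l \<le> height x (take j w)" if "j \<le> length w" for j
      using R[rule_format, of "Suc j"] that by (simp add: algebra_simps)
    then show ?L
      using R[rule_format, of 0] by auto
  qed
  finally show ?case .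
qed simp

fun quasi_shuffle :: "'n word \<Rightarrow> 'n word \<Rightarrow> (complex \<times> 'n word) list" where
  "quasi_shuffle [] v = [(1, v)]"
| "quasi_shuffle (k # u) [] = [(1, k # u)]"
| "quasi_shuffle (k # u) (l # v) =
    map (\<lambda>(c, w). (c, k # w)) (quasi_shuffle u (l # v)) @
    map (\<lambda>(c, w). (c, l # w)) (quasi_shuffle (k # u) v) @
    map (\<lambda>(c, w). (- c, (fst k \<union> fst l, snd k + snd l) # w)) (quasi_shuffle u v)"

lemma quasi_shuffle_letters:
  "(c, w) \<in> set (quasi_shuffle u v) \<Longrightarrow> letters w = letters u \<union> letters v \<and> weight w = weight u + weight v"
proof (induction u v arbitrary: c w rule: quasi_shuffle.induct)
  case (3 k u l v)
  from "3.prems" consider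
    (1) c' w' where "(c', w') \<in> set (quasi_shuffle u (l # v))" "w = k # w'"
  | (2) c' w' where "(c', w') \<in> set (quasi_shuffle (k # u) v)" "w = l # w'"
  | (3) c' w' where "(c', w') \<in> set (quasi_shuffle u v)" "w = (fst k \<union> fst l, snd k + snd l) # w'"
    by auto
  then show ?case
  proof cases
    case 1
    with "3.IH"(1)[OF 1(1)] show ?thesis by auto
  next
    case 2
    with "3.IH"(2)[OF 2(1)] show ?thesis by auto
  next
    case 3
    with "3.IH"(3)[OF 3(1)] show ?thesis by auto
  qed
qed auto

lemma quasi_shuffle_valid:
  "(c, w) \<in> set (quasi_shuffle u v) \<Longrightarrow> valid_word u \<Longrightarrow> valid_word v \<Longrightarrow>
    letters u \<inter> letters v = {} \<Longrightarrow> valid_word w"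
proof (induction u v arbitrary: c w rule: quasi_shuffle.induct)
  case (3 k u l v)
  from "3.prems"(1) consider
    (1) c' w' where "(c', w') \<in> set (quasi_shuffle u (l # v))" "w = k # w'"
  | (2) c' w' where "(c', w') \<in> set (quasi_shuffle (k # u) v)" "w = l # w'"
  | (3) c' w' where "(c', w') \<in> set (quasi_shuffle u v)" "w = (fst k \<union> fst l, snd k + snd l) # w'"
    by auto
  then show ?case
  proof cases
    case 1
    with "3.IH"(1)[OF 1(1)] "3.prems"(2-) quasi_shuffle_letters[OF 1(1)] show ?thesis by auto
  next
    case 2
    with "3.IH"(2)[OF 2(1)] "3.prems"(2-) quasi_shuffle_letters[OF 2(1)] show ?thesis by auto
  next
    case 3
    with "3.IH"(3)[OF 3(1)] "3.prems"(2-) quasi_shuffle_letters[OF 3(1)] show ?thesis by auto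
  qed
qed auto

lemma step_merge:
  "fst k \<inter> fst l = {} \<Longrightarrow> step x (fst k \<union> fst l, snd k + snd l) = step x k + step x l"
  by (simp add: step_def sum.union_disjoint)

text \<open>
  Both sides read off the minimum of \<open>V i + W j\<close> over a grid, on the left along signed monotone
  lattice paths (a diagonal step has sign \<open>-1\<close>). Splitting off the first step, the three sums
  cancel unless the minimum lies where the grid minimum does.
\<close>

lemma quasi_shuffle_lowest:
  fixes \<psi> :: "real \<Rightarrow> nat \<Rightarrow> complex"
  assumes "valid_word u" "valid_word v" "letters u \<inter> letters v = {}"
  shows "(\<Sum>(c, w)\<leftarrow>quasi_shuffle u v. c * \<psi> (lowest x w) (lowest_pos x w)) =
    \<psi> (lowest x u + lowest x v) (lowest_pos x u + lowest_pos x v)"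
  using assms
proof (induction u v arbitrary: \<psi> rule: quasi_shuffle.induct)
  case (3 k u l v)
  \<comment> \<open>\<open>\<phi> l\<close> is \<open>\<psi>\<close> read after the letter
    \<open>l\<close> is put in front. This mixes the minimum with its position, so the induction has
    to range over all functions of both.\<close>
  define \<phi> where "\<phi> = (\<lambda>l m (p::nat). if step x l + m < 0 then \<psi> (step x l + m) (snd l + p) else \<psi> 0 0)"
  have \<phi>: "\<psi> (lowest x (l # w)) (lowest_pos x (l # w)) = \<phi> l (lowest x w) (lowest_pos x w)" for l w
    by (auto simp: \<phi>_def min_def)
  have neg: "(\<Sum>z\<leftarrow>zs. - g z) = - sum_list (map g zs)" for g :: "complex \<times> 'a word \<Rightarrow> complex" and zs
    by (induction zs) auto
  let ?kl = "(fst k \<union> fst l, snd k + snd l)"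
  have st: "step x ?kl = step x k + step x l"
    using "3.prems" by (intro step_merge) auto
  have "(\<Sum>(c, w)\<leftarrow>quasi_shuffle (k # u) (l # v). c * \<psi> (lowest x w) (lowest_pos x w)) =
      (\<Sum>(c, w)\<leftarrow>quasi_shuffle u (l # v). c * \<phi> k (lowest x w) (lowest_pos x w)) +
      (\<Sum>(c, w)\<leftarrow>quasi_shuffle (k # u) v. c * \<phi> l (lowest x w) (lowest_pos x w)) -
      (\<Sum>(c, w)\<leftarrow>quasi_shuffle u v. c * \<phi> ?kl (lowest x w) (lowest_pos x w))"
    by (simp add: o_def case_prod_unfold \<phi> neg del: lowest.simps lowest_pos.simps)
  also have "(\<Sum>(c, w)\<leftarrow>quasi_shuffle u (l # v). c * \<phi> k (lowest x w) (lowest_pos x w)) =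
      \<phi> k (lowest x u + lowest x (l # v)) (lowest_pos x u + lowest_pos x (l # v))"
    using "3.prems" by (intro "3.IH"(1)) auto
  also have "(\<Sum>(c, w)\<leftarrow>quasi_shuffle (k # u) v. c * \<phi> l (lowest x w) (lowest_pos x w)) =
      \<phi> l (lowest x (k # u) + lowest x v) (lowest_pos x (k # u) + lowest_pos x v)"
    using "3.prems" by (intro "3.IH"(2)) auto
  also have "(\<Sum>(c, w)\<leftarrow>quasi_shuffle u v. c * \<phi> ?kl (lowest x w) (lowest_pos x w)) =
      \<phi> ?kl (lowest x u + lowest x v) (lowest_pos x u + lowest_pos x v)"
    using "3.prems" by (intro "3.IH"(3)) auto
  also have "\<phi> k (lowest x u + lowest x (l # v)) (lowest_pos x u + lowest_pos x (l # v)) +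
      \<phi> l (lowest x (k # u) + lowest x v) (lowest_pos x (k # u) + lowest_pos x v) -
      \<phi> ?kl (lowest x u + lowest x v) (lowest_pos x u + lowest_pos x v) =
      \<psi> (lowest x (k # u) + lowest x (l # v)) (lowest_pos x (k # u) + lowest_pos x (l # v))"
    \<comment> \<open>If both tested sums are negative or both are nonnegative, the three terms
      agree and 1 + 1 - 1 = 1. Otherwise the merged term cancels the one that starts with the letter
      of the nonnegative sum.\<close>
    by (cases "step x k + lowest x u < 0"; cases "step x l + lowest x v < 0")
      (auto simp: \<phi>_def st algebra_simps min_def)
  finally show ?case .
qed auto

text \<open>Letters and weight are only bounded, since the telescoping below drops letters. The
  bound on letters keeps the factors of a product disjoint, the one on weight keeps all words below
  \<open>r\<close>.\<close>

definition word_span :: "complex \<Rightarrow> 'n set \<Rightarrow> nat \<Rightarrow> (real ^ 'n::finite \<Rightarrow> complex) set" where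
  "word_span z L n = {F. \<exists>ks. (\<forall>(c, w)\<in>set ks. valid_word w \<and> letters w \<subseteq> L \<and> weight w \<le> n) \<and>
     F = (\<lambda>x. \<Sum>(c, w)\<leftarrow>ks. c * z ^ lowest_pos x w)}"

definition nonneg_walk :: "'n word \<Rightarrow> real ^ 'n::finite \<Rightarrow> complex" where
  "nonneg_walk w x = (if lowest x w = 0 then 1 else 0)"

lemma word_span_base:
  "valid_word w \<Longrightarrow> letters w \<subseteq> L \<Longrightarrow> weight w \<le> n \<Longrightarrow> (\<lambda>x. z ^ lowest_pos x w) \<in> word_span z L n"
  unfolding word_span_def by (intro CollectI exI[of _ "[(1, w)]"]) auto

lemma word_span_mono: "L \<subseteq> L' \<Longrightarrow> n \<le> n' \<Longrightarrow> F \<in> word_span z L n \<Longrightarrow> F \<in> word_span z L' n'"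
  unfolding word_span_def by fastforce

lemma word_span_add:
  assumes "F \<in> word_span z L n" "G \<in> word_span z L n"
  shows "(\<lambda>x. F x + G x) \<in> word_span z L n"
proof -
  obtain ks ls where "\<forall>(c, w)\<in>set ks. valid_word w \<and> letters w \<subseteq> L \<and> weight w \<le> n"
    "F = (\<lambda>x. \<Sum>(c, w)\<leftarrow>ks. c * z ^ lowest_pos x w)"
    "\<forall>(c, w)\<in>set ls. valid_word w \<and> letters w \<subseteq> L \<and> weight w \<le> n"
    "G = (\<lambda>x. \<Sum>(c, w)\<leftarrow>ls. c * z ^ lowest_pos x w)"
    using assms unfolding word_span_def by blast
  then show ?thesis
    unfolding word_span_def by (intro CollectI exI[of _ "ks @ ls"]) auto
qed

lemma word_span_scale:
  assumes "F \<in> word_span z L n"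
  shows "(\<lambda>x. c * F x) \<in> word_span z L n"
proof -
  obtain ks where "\<forall>(c, w)\<in>set ks. valid_word w \<and> letters w \<subseteq> L \<and> weight w \<le> n"
    "F = (\<lambda>x. \<Sum>(c, w)\<leftarrow>ks. c * z ^ lowest_pos x w)"
    using assms unfolding word_span_def by blast
  then show ?thesis
    unfolding word_span_def
    by (intro CollectI exI[of _ "map (\<lambda>(d, w). (c * d, w)) ks"])
      (auto simp: o_def case_prod_unfold mult.assoc sum_list_const_mult)
qed

lemma word_span_diff:
  assumes "F \<in> word_span z L n" "G \<in> word_span z L n"
  shows "(\<lambda>x. F x - G x) \<in> word_span z L n"
  using word_span_add[OF assms(1) word_span_scale[OF assms(2), of "- 1"]] by simp

lemma word_span_0: "(\<lambda>x. 0) \<in> word_span z L n"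
  unfolding word_span_def by (intro CollectI exI[of _ "[]"]) auto

lemma word_span_sum_list:
  "(\<And>k. k \<in> set ks \<Longrightarrow> F k \<in> word_span z L n) \<Longrightarrow> (\<lambda>x. \<Sum>k\<leftarrow>ks. F k x) \<in> word_span z L n"
  by (induction ks) (auto intro: word_span_0 word_span_add)

text \<open>\<open>quasi_shuffle_lowest\<close>, with a \<open>\<psi>\<close> that is a power of
  \<open>z\<close> in the position alone, rewrites a product of two generators as a combination of
  generators.\<close>

lemma word_span_mult:
  assumes F: "F \<in> word_span z L n" and G: "G \<in> word_span z L' n'" and "L \<inter> L' = {}"
  shows "(\<lambda>x. F x * G x) \<in> word_span z (L \<union> L') (n + n')"
proof -
  obtain ks where ks: "\<And>k. k \<in> set ks \<Longrightarrow> valid_word (snd k) \<and> letters (snd k) \<subseteq> L \<and> weight (snd k) \<le> n"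
    and F: "F = (\<lambda>x. \<Sum>k\<leftarrow>ks. fst k * z ^ lowest_pos x (snd k))"
    using F unfolding word_span_def by (auto simp: case_prod_unfold)
  obtain ls where ls: "\<And>k. k \<in> set ls \<Longrightarrow> valid_word (snd k) \<and> letters (snd k) \<subseteq> L' \<and> weight (snd k) \<le> n'"
    and G: "G = (\<lambda>x. \<Sum>k\<leftarrow>ls. fst k * z ^ lowest_pos x (snd k))"
    using G unfolding word_span_def by (auto simp: case_prod_unfold)
  have prod: "(\<lambda>x. z ^ lowest_pos x u * z ^ lowest_pos x v) \<in> word_span z (L \<union> L') (n + n')"
    if u: "valid_word u" "letters u \<subseteq> L" "weight u \<le> n"
      and v: "valid_word v" "letters v \<subseteq> L'" "weight v \<le> n'" for u v
  proof -
    have disj: "letters u \<inter> letters v = {}"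
      using u v assms(3) by blast
    have "(\<lambda>x. z ^ lowest_pos x u * z ^ lowest_pos x v) =
        (\<lambda>x. \<Sum>(c, w)\<leftarrow>quasi_shuffle u v. c * z ^ lowest_pos x w)"
      using quasi_shuffle_lowest[OF u(1) v(1) disj, of "\<lambda>_ p. z ^ p"] by (simp add: power_add)
    moreover have "valid_word w \<and> letters w \<subseteq> L \<union> L' \<and> weight w \<le> n + n'"
      if "(c, w) \<in> set (quasi_shuffle u v)" for c w
      using quasi_shuffle_letters[OF that] quasi_shuffle_valid[OF that u(1) v(1) disj] u v by auto
    ultimately show ?thesis
      unfolding word_span_def by blast
  qed
  have "F x * G x = (\<Sum>k\<leftarrow>ks. fst k * (z ^ lowest_pos x (snd k) * G x))" for x
    by (simp add: F sum_list_mult_const[symmetric] mult.assoc)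
  moreover have "z ^ p * G x = (\<Sum>l\<leftarrow>ls. fst l * (z ^ p * z ^ lowest_pos x (snd l)))" for p x
    by (simp add: G sum_list_const_mult[symmetric] mult.left_commute)
  ultimately have "(\<lambda>x. F x * G x) =
      (\<lambda>x. \<Sum>k\<leftarrow>ks. fst k * (\<Sum>l\<leftarrow>ls. fst l * (z ^ lowest_pos x (snd k) * z ^ lowest_pos x (snd l))))"
    by simp
  then show ?thesis
    by (simp only:) (intro word_span_sum_list word_span_scale prod; simp add: ks ls)
qed

text \<open>
  Write \<open>w = A @ B\<close>. If the walk is nonnegative along \<open>A\<close> but not along \<open>w\<close>, the first letter of \<open>B\<close>
  can be moved to \<open>A\<close> without moving the minimum of the part after \<open>A\<close>. Telescoping over all
  cuts of \<open>w\<close> expresses \<open>(1 - z ^ weight w) * nonneg_walk w\<close> by products in which the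
  \<open>nonneg_walk\<close> factor belongs to a proper prefix.
\<close>

lemma nonneg_walk_in_word_span:
  assumes "valid_word w" and z: "\<And>n. 0 < n \<Longrightarrow> n \<le> weight w \<Longrightarrow> z ^ n \<noteq> 1"
  shows "nonneg_walk w \<in> word_span z (letters w) (weight w)"
  using assms
proof (induction w rule: length_induct)
  case (1 w)
  show ?case
  proof (cases "w = []")
    case True
    then show ?thesis
      using word_span_base[of "[]" "{}" 0 z] by (simp add: nonneg_walk_def[abs_def])
  next
    case False
    let ?S = "word_span z (letters w) (weight w)"
    let ?D = "\<lambda>A B x. (nonneg_walk A x - nonneg_walk w x) * (z ^ weight A * z ^ lowest_pos x B)"
    have prefix: "nonneg_walk A \<in> word_span z (letters A) (weight A)" if "w = A @ B" "B \<noteq> []" for A B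
      using 1 that by (auto simp: valid_word_append)
    \<comment> \<open>Both sides vanish unless \<open>A\<close> stays nonnegative and
      \<open>w\<close> does not; in that case the minimum of \<open>l # B\<close> is negative, so
      \<open>lowest_pos\<close> passes the letter \<open>l\<close>.\<close>
    have peel: "?D A (l # B) x = ?D A B x * z ^ snd l" if "w = A @ l # B" for A l B x
    proof (cases "lowest x A = 0 \<and> lowest x w \<noteq> 0")
      case True
      then have "height x A + lowest x (l # B) < 0"
        using that lowest_le_0[of x w] by (auto simp: lowest_append min_def split: if_splits)
      moreover have "0 \<le> height x A"
        using lowest_le_height[of x A] True by simp
      ultimately have "lowest x (l # B) < 0" by linarith
      then have "step x l + lowest x B < 0"
        by auto
      then show ?thesis
        by (simp add: power_add)
    next
      case False
      then have "nonneg_walk A x = nonneg_walk w x"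
        using that lowest_le_0[of x A] lowest_le_0[of x w]
        by (auto simp: nonneg_walk_def lowest_append min_def split: if_splits)
      then show ?thesis by simp
    qed
    \<comment> \<open>In the applications \<open>C\<close> is empty or the single letter just peeled
      off. Either way \<open>A\<close> is a proper prefix, so the induction hypothesis covers
      it.\<close>
    have prod: "(\<lambda>x. nonneg_walk A x * (z ^ weight A * z ^ lowest_pos x B)) \<in> ?S"
      if "w = A @ C @ B" "C @ B \<noteq> []" for A B C
    proof -
      have "(\<lambda>x. nonneg_walk A x * z ^ lowest_pos x B) \<in> word_span z (letters A \<union> letters B) (weight A + weight B)"
        using that 1(2) prefix[OF that]
        by (intro word_span_mult word_span_base) (auto simp: valid_word_append)
      then have "(\<lambda>x. nonneg_walk A x * z ^ lowest_pos x B) \<in> ?S"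
        using that by (elim word_span_mono[rotated 2]) auto
      from word_span_scale[OF this, of "z ^ weight A"] show ?thesis
        by (simp add: mult_ac)
    qed
    have main: "\<exists>F\<in>?S. \<forall>x. ?D A B x = F x - z ^ weight w * nonneg_walk w x"
      if "w = A @ B" "B \<noteq> []" for A B
      using that
    proof (induction B arbitrary: A)
      case (Cons l B)
      show ?case
      proof (cases "B = []")
        case True
        have "(\<lambda>x. z ^ snd l * (nonneg_walk A x * (z ^ weight A * z ^ lowest_pos x []))) \<in> ?S"
          using Cons.prems True by (intro word_span_scale prod[where C = "[l]"]) auto
        moreover have "?D A (l # B) x = z ^ snd l * (nonneg_walk A x * (z ^ weight A * z ^ lowest_pos x [])) - z ^ weight w * nonneg_walk w x" for x
          using peel[of A l B x] Cons.prems True by (simp add: power_add algebra_simps)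
        ultimately show ?thesis
          by (intro bexI[of _ "\<lambda>x. z ^ snd l * (nonneg_walk A x * (z ^ weight A * z ^ lowest_pos x []))"]) auto
      next
        case False
        then obtain F where F: "F \<in> ?S" "\<And>x. ?D (A @ [l]) B x = F x - z ^ weight w * nonneg_walk w x"
          using Cons.IH[of "A @ [l]"] Cons.prems by auto
        \<comment> \<open>By \<open>peel\<close>, moving the cut from \<open>A\<close> to
          \<open>A @ [l]\<close> changes \<open>?D\<close> by two products whose walk factors are
          proper prefixes, while the terms with \<open>nonneg_walk w\<close> agree.\<close>
        let ?H = "\<lambda>x. F x + z ^ snd l * (nonneg_walk A x * (z ^ weight A * z ^ lowest_pos x B))
          - nonneg_walk (A @ [l]) x * (z ^ weight (A @ [l]) * z ^ lowest_pos x B)"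
        have "?H \<in> ?S"
          using Cons.prems False
          by (intro word_span_diff word_span_add F(1) word_span_scale prod[where C = "[l]"] prod[where C = "[]"]) auto
        moreover have "?D A (l # B) x = ?H x - z ^ weight w * nonneg_walk w x" for x
          using peel[of A l B x] Cons.prems F(2)[of x] by (simp add: power_add algebra_simps)
        ultimately show ?thesis
          by (intro bexI[of _ ?H]) auto
      qed
    qed simp
    obtain F where F: "F \<in> ?S" "\<And>x. ?D [] w x = F x - z ^ weight w * nonneg_walk w x"
      using main[of "[]" w] False by auto
    \<comment> \<open>Where \<open>nonneg_walk w\<close> is 1, the minimum sits at position 0 and
      the power is 1.\<close>
    have "(1 - nonneg_walk w x) * z ^ lowest_pos x w = z ^ lowest_pos x w - nonneg_walk w x" for x
      by (simp add: nonneg_walk_def lowest_pos_eq_0)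
    with F(2) have "(1 - z ^ weight w) * nonneg_walk w x = z ^ lowest_pos x w - F x" for x
      by (simp add: nonneg_walk_def[of "[]"] algebra_simps)
    moreover have "z ^ weight w \<noteq> 1"
      using 1(2,3) weight_pos[OF _ False] by simp
    ultimately have eq: "nonneg_walk w = (\<lambda>x. (1 / (1 - z ^ weight w)) * (z ^ lowest_pos x w - F x))"
      by (auto simp: fun_eq_iff eq_divide_eq mult.commute)
    show ?thesis
      unfolding eq using 1(2) by (intro word_span_scale word_span_diff F(1) word_span_base) auto
  qed
qed

section \<open>Minima of walks\<close>

definition walk :: "('n \<Rightarrow> nat) \<Rightarrow> real ^ 'n::finite \<Rightarrow> nat \<Rightarrow> real" where
  "walk f x t = (\<Sum>b | f b < t. x $ b) - real t"

definition walk_min :: "nat \<Rightarrow> ('n \<Rightarrow> nat) \<Rightarrow> real ^ 'n::finite \<Rightarrow> nat" where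
  "walk_min r f x = (LEAST t. t < r \<and> (\<forall>s<r. walk f x t \<le> walk f x s))"

text \<open>
  By the cycle lemma, the rotation of the plate of \<open>f\<close> that contains a generic point starts at
  \<open>walk_min\<close>, so \<open>root_fun\<close> is a sum of rotated plates with roots of unity as coefficients.
\<close>

definition root_fun :: "nat \<Rightarrow> ('n \<Rightarrow> nat) \<Rightarrow> real ^ 'n::finite \<Rightarrow> complex" where
  "root_fun r f = restrict_to_simplex r (\<lambda>x. unity_root r (int (walk_min r f x)))"

text \<open>Translates a word into a map \<open>f\<close>. Elements outside all letters get the full
  weight, which is the start of the dropped last lump.\<close>

fun starts :: "'n word \<Rightarrow> 'n \<Rightarrow> nat" where
  "starts [] b = 0"
| "starts (l # w) b = (if b \<in> fst l then 0 else snd l + starts w b)"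

lemma starts_le: "starts w b \<le> weight w"
  by (induction w) auto

lemma starts_notin: "b \<notin> letters w \<Longrightarrow> starts w b = weight w"
  by (induction w) auto

lemma walk_starts_Cons_low:
  assumes "0 < t" "t \<le> snd l"
  shows "walk (starts (l # w)) x t = (\<Sum>a\<in>fst l. x $ a) - real t"
proof -
  have "{b. starts (l # w) b < t} = fst l"
    using assms by auto
  then show ?thesis
    by (simp add: walk_def)
qed

lemma walk_starts_Cons_high:
  assumes "valid_word (l # w)" "snd l \<le> t" "t \<le> weight (l # w)"
  shows "walk (starts (l # w)) x t = step x l + walk (starts w) x (t - snd l)"
proof -
  have in_l: "starts w b = weight w" if "b \<in> fst l" for b
    using that assms(1) by (intro starts_notin) auto
  have "{b. starts (l # w) b < t} = fst l \<union> {b. starts w b < t - snd l}"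
    using assms by auto
  moreover have "fst l \<inter> {b. starts w b < t - snd l} = {}"
    using in_l assms(3) by auto
  ultimately show ?thesis
    using assms(2) by (simp add: walk_def step_def sum.union_disjoint of_nat_diff del: starts.simps)
qed

text \<open>Strictly between two lump starts the walk falls with slope -1 and stays above its value
  at the later one. So its minimum up to \<open>weight w\<close> is attained, and attained earliest,
  at a prefix of the word.\<close>

lemma walk_starts_aux:
  assumes "valid_word w"
  shows "walk (starts w) x (lowest_pos x w) = lowest x w \<and> lowest_pos x w \<le> weight w \<and>
    (\<forall>t\<le>weight w. lowest x w \<le> walk (starts w) x t) \<and>
    (\<forall>t<lowest_pos x w. lowest x w < walk (starts w) x t)"
  using assms
proof (induction w)
  case (Cons l w)
  note high = walk_starts_Cons_high[OF Cons.prems]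
  have IH: "walk (starts w) x (lowest_pos x w) = lowest x w" "lowest_pos x w \<le> weight w"
    "\<And>t. t \<le> weight w \<Longrightarrow> lowest x w \<le> walk (starts w) x t"
    "\<And>t. t < lowest_pos x w \<Longrightarrow> lowest x w < walk (starts w) x t"
    using Cons by auto
  have cases: "t = 0 \<or> 0 < t \<and> t < snd l \<or> snd l \<le> t" for t
    by auto
  have low: "step x l < walk (starts (l # w)) x t" if "0 < t" "t < snd l" for t
    using that by (simp add: walk_starts_Cons_low step_def del: starts.simps)
  have "walk (starts (l # w)) x (lowest_pos x (l # w)) = lowest x (l # w)"
    using IH(1,2) high[of "snd l + lowest_pos x w"]
    by (simp add: walk_def[of _ _ 0] del: starts.simps)
  moreover have "lowest_pos x (l # w) \<le> weight (l # w)"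
    using IH(2) by simp
  moreover have "lowest x (l # w) \<le> walk (starts (l # w)) x t" if t: "t \<le> weight (l # w)" for t
  proof -
    have "t - snd l \<le> weight w"
      using t by simp
    from IH(3)[OF this] show ?thesis
      using t cases[of t] low[of t] high[of t] lowest_le_0[of x w]
      by (auto simp: walk_def[of _ _ 0] min_def simp del: starts.simps)
  qed
  moreover have "lowest x (l # w) < walk (starts (l # w)) x t" if "t < lowest_pos x (l # w)" for t
    using that cases[of t] low[of t] high[of t] IH(4)[of "t - snd l"] IH(2) lowest_le_0[of x w]
    by (auto simp: walk_def[of _ _ 0] min_def simp del: starts.simps split: if_splits)
  ultimately show ?case
    by blast
qed (auto simp: walk_def)

lemma walk_starts:
  assumes "valid_word w"
  shows "walk (starts w) x (lowest_pos x w) = lowest x w" "lowest_pos x w \<le> weight w"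
    "t \<le> weight w \<Longrightarrow> lowest x w \<le> walk (starts w) x t"
    "t < lowest_pos x w \<Longrightarrow> lowest x w < walk (starts w) x t"
  using walk_starts_aux[OF assms, of x] by auto

lemma walk_min_starts:
  assumes "valid_word w" "weight w < r" "x \<in> dilated_simplex r"
  shows "walk_min r (starts w) x = lowest_pos x w"
proof -
  note ws = walk_starts[OF assms(1)]
  have "lowest x w \<le> walk (starts w) x t" if "t < r" for t
  proof (cases "t \<le> weight w")
    case False
    \<comment> \<open>Past \<open>weight w\<close> all coordinates are counted, so the walk is
      \<open>r - t\<close>, which is positive, while the minimum is at most 0.\<close>
    then have "starts w b < t" for b
      using starts_le[of w b] by linarith
    then have "walk (starts w) x t = real r - real t"
      using assms(3) by (simp add: walk_def dilated_simplex_def)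
    then show ?thesis
      using that lowest_le_0[of x w] by simp
  qed (rule ws(3))
  then have min: "walk (starts w) x (lowest_pos x w) \<le> walk (starts w) x t" if "t < r" for t
    using that by (simp add: ws(1))
  have lt: "lowest_pos x w < r"
    using ws(2)[of x] assms(2) by simp
  show ?thesis
    unfolding walk_min_def
  proof (rule Least_equality)
    show "lowest_pos x w < r \<and> (\<forall>s<r. walk (starts w) x (lowest_pos x w) \<le> walk (starts w) x s)"
      using lt min by blast
  next
    fix t assume "t < r \<and> (\<forall>s<r. walk (starts w) x t \<le> walk (starts w) x s)"
    then show "lowest_pos x w \<le> t"
      using ws(4)[of t x] ws(1)[of x] lt by (metis not_le)
  qed
qed

lemma root_fun_starts:
  assumes "valid_word w" "weight w < r"
  shows "restrict_to_simplex r (\<lambda>x. unity_root r 1 ^ lowest_pos x w) = root_fun r (starts w)"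
  using walk_min_starts[OF assms] unity_root_mult_nat[of r 1]
  by (auto simp: root_fun_def restrict_to_simplex_def)

section \<open>Plates as combinations of root classes\<close>

lemma thin_class_add: "thin_class (\<lambda>x. f x + g x) = thin_class f + thin_class g"
  by (simp add: plus_thin_fun.abs_eq)

lemma thin_class_scale: "thin_class (\<lambda>x. c * f x) = scale_thin_fun c (thin_class f)"
  by (simp add: scale_thin_fun.abs_eq)

lemma thin_class_0: "thin_class (\<lambda>x. 0) = 0"
  by (simp add: zero_thin_fun.abs_eq)

lemma thin_class_sum:
  "thin_class (\<lambda>x. \<Sum>i\<in>I. c i * f i x) = (\<Sum>i\<in>I. scale_thin_fun (c i) (thin_class (f i)))"
  by (induction I rule: infinite_finite_induct)
    (simp_all add: thin_class_0 thin_class_add thin_class_scale)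

definition root_classes :: "nat \<Rightarrow> 'n::finite thin_fun set" where
  "root_classes r = (\<lambda>f. thin_class (root_fun r f)) ` {f. \<forall>b. f b < r}"

lemma word_span_root_classes:
  assumes "F \<in> word_span (unity_root r 1) L n" "n < r"
  shows "thin_class (restrict_to_simplex r F) \<in> thin_fun.span (root_classes r)"
proof -
  obtain ks where ks: "\<And>c w. (c, w) \<in> set ks \<Longrightarrow> valid_word w \<and> weight w \<le> n"
    and F: "F = (\<lambda>x. \<Sum>(c, w)\<leftarrow>ks. c * unity_root r 1 ^ lowest_pos x w)"
    using assms(1) unfolding word_span_def by blast
  show ?thesis
    using ks unfolding F
  proof (induction ks)
    case Nil
    then show ?case
      by (simp add: restrict_to_simplex_def thin_class_0 thin_fun.span_zero)
  next
    case (Cons k ks)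
    obtain c w where k: "k = (c, w)" by force
    let ?z = "unity_root r 1"
    let ?G = "restrict_to_simplex r (\<lambda>x. \<Sum>(c, w)\<leftarrow>ks. c * ?z ^ lowest_pos x w)"
    have w: "valid_word w" "weight w < r"
      using Cons.prems[of c w] k assms(2) by auto
    have "restrict_to_simplex r (\<lambda>x. \<Sum>(c, w)\<leftarrow>k # ks. c * ?z ^ lowest_pos x w) =
        (\<lambda>x. c * root_fun r (starts w) x + ?G x)"
      unfolding root_fun_starts[OF w, symmetric] by (auto simp: k restrict_to_simplex_def)
    then have "thin_class (restrict_to_simplex r (\<lambda>x. \<Sum>(c, w)\<leftarrow>k # ks. c * ?z ^ lowest_pos x w)) =
        scale_thin_fun c (thin_class (root_fun r (starts w))) + thin_class ?G"
      by (simp only: thin_class_add thin_class_scale)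
    moreover have "thin_class (root_fun r (starts w)) \<in> root_classes r"
      unfolding root_classes_def using starts_le[of w] w(2) by (intro imageI) (auto intro: le_less_trans)
    moreover have "thin_class ?G \<in> thin_fun.span (root_classes r)"
      using Cons.prems by (intro Cons.IH) auto
    ultimately show ?case
      by (simp only: thin_fun.span_add thin_fun.span_scale thin_fun.span_base)
  qed
qed

lemma valid_word_zip:
  assumes "distinct Ss" "disjoint (set Ss)" "length ss = length Ss" "\<forall>s\<in>set ss. 0 < s"
  shows "valid_word (zip Ss ss) \<and> letters (zip Ss ss) = \<Union>(set Ss)"
  using assms
proof (induction Ss arbitrary: ss)
  case (Cons S Ss)
  obtain s ss' where ss: "ss = s # ss'"
    using Cons.prems(3) by (cases ss) auto
  have "disjoint (set Ss)"
    using Cons.prems(2) by (auto simp: disjoint_def)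
  then have "valid_word (zip Ss ss') \<and> letters (zip Ss ss') = \<Union>(set Ss)"
    using Cons.prems ss by (intro Cons.IH) auto
  moreover have "S \<inter> \<Union>(set Ss) = {}"
    using Cons.prems(1,2) by (fastforce simp: disjoint_def)
  ultimately show ?case
    using Cons.prems(4) by (auto simp: ss)
qed simp

lemma height_take_zip:
  assumes "length ss = length Ss" "j \<le> length Ss"
  shows "height x (take j (zip Ss ss)) = (\<Sum>i<j. \<Sum>a\<in>Ss ! i. x $ a) - real (\<Sum>i<j. ss ! i)"
  using assms(2)
proof (induction j)
  case (Suc j)
  have "height x (u @ v) = height x u + height x v" for u v
    by (simp add: height_def)
  then show ?case
    using Suc assms(1) by (simp add: take_Suc_conv_app_nth step_def)
qed simp

lemma sum_ordered_set_partition: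
  assumes "ordered_set_partition Ss"
  shows "(\<Sum>i<length Ss. \<Sum>a\<in>Ss ! i. g a) = (\<Sum>a\<in>UNIV. g (a::'n::finite)::real)"
proof -
  have "(\<Sum>i<length Ss. \<Sum>a\<in>Ss ! i. g a) = sum_list (map (\<lambda>S. \<Sum>a\<in>S. g a) Ss)"
    by (simp add: sum_list_sum_nth atLeast0LessThan)
  also have "\<dots> = (\<Sum>S\<in>set Ss. \<Sum>a\<in>S. g a)"
    using assms by (simp add: ordered_set_partition_def sum_list_distinct_conv_sum_set)
  also have "\<dots> = (\<Sum>a\<in>\<Union>(set Ss). g a)"
    using assms unfolding ordered_set_partition_def partition_on_def disjoint_def
    by (subst sum.Union_disjoint) auto
  also have "\<Union>(set Ss) = UNIV"
    using assms unfolding ordered_set_partition_def partition_on_def by simp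
  finally show ?thesis .
qed

text \<open>The plate inequalities concern proper prefixes, which are the prefixes of the word
  without its last letter; the closing equation holds on the whole simplex.\<close>

lemma restrict_plate_eq_nonneg_walk:
  assumes "ordered_set_partition Ss" "length ss = length Ss" "sum_list ss = r"
  shows "restrict_to_simplex r (plate Ss ss) = restrict_to_simplex r (nonneg_walk (butlast (zip Ss ss)))"
proof -
  have "x \<in> plate_set Ss ss \<longleftrightarrow> lowest x (butlast (zip Ss ss)) = 0"
    if "x \<in> dilated_simplex r" for x :: "real ^ 'a"
  proof -
    let ?w = "butlast (zip Ss ss)"
    have len: "length ?w = length Ss - 1"
      using assms(2) by simp
    have "(\<Sum>i<length Ss. \<Sum>a\<in>Ss ! i. x $ a) = real (\<Sum>i<length Ss. ss ! i)"
      using that assms sum_ordered_set_partition[OF assms(1), of "($) x"]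
      by (simp add: dilated_simplex_def sum_list_sum_nth atLeast0LessThan)
    then have "x \<in> plate_set Ss ss \<longleftrightarrow>
        (\<forall>j\<in>{1..<length Ss}. 0 \<le> height x (take j (zip Ss ss)))"
      using assms(2) by (auto simp: plate_set_def height_take_zip)
    also have "\<dots> \<longleftrightarrow> (\<forall>j\<le>length ?w. 0 \<le> height x (take j ?w))"
    proof -
      have "take j ?w = take j (zip Ss ss)" if "j \<le> length Ss - 1" for j
        using that assms(2) by (simp add: butlast_conv_take take_take min_def)
      moreover have "j \<in> {1..<length Ss} \<longleftrightarrow> j \<noteq> 0 \<and> j \<le> length Ss - 1" for j
        by auto
      ultimately show ?thesis
        unfolding len by (metis height_simps(1) order_refl take_0)
    qed
    also have "\<dots> \<longleftrightarrow> lowest x ?w = 0"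
      using le_lowest_iff[of 0 x ?w] lowest_le_0[of x ?w] by auto
    finally show ?thesis .
  qed
  then show ?thesis
    by (auto simp: restrict_to_simplex_def plate_def nonneg_walk_def fun_eq_iff indicator_def)
qed

text \<open>The last position is positive, so the remaining word has weight below \<open>r\<close>,
  and a primitive \<open>r\<close>-th root of unity satisfies the hypothesis of
  \<open>nonneg_walk_in_word_span\<close>.\<close>

lemma Pl_subset_span_root_classes:
  assumes "r \<ge> 1"
  shows "Pl r \<subseteq> thin_fun.span (root_classes r :: 'n::finite thin_fun set)"
proof -
  have "v \<in> thin_fun.span (root_classes r)" if v_mem: "v \<in> plate_classes r" for v :: "'n thin_fun"
  proof -
    obtain Ss ss where v: "v = thin_class (restrict_to_simplex r (plate Ss ss))"
      and *: "ordered_set_partition Ss" "length ss = length Ss" "\<forall>s\<in>set ss. 0 < s" "sum_list ss = r"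
      using v_mem unfolding plate_classes_def by blast
    let ?w = "butlast (zip Ss ss)"
    have "ss \<noteq> []"
      using *(4) assms by auto
    then have ne: "zip Ss ss \<noteq> []"
      using *(2) by (cases Ss; cases ss) auto
    have "valid_word (zip Ss ss)"
      using * valid_word_zip[of Ss ss] by (simp add: ordered_set_partition_def partition_on_def)
    then have "valid_word (?w @ [last (zip Ss ss)])"
      using ne by simp
    then have valid: "valid_word ?w" and pos: "0 < snd (last (zip Ss ss))"
      unfolding valid_word_append by simp_all
    have "weight (?w @ [last (zip Ss ss)]) = r"
      using ne *(2,4) by (simp add: weight_def del: weight_simps)
    then have wt: "weight ?w < r"
      using pos by simp
    have "unity_root r 1 ^ m \<noteq> 1" if "0 < m" "m \<le> weight ?w" for m
      using unity_root_mult_nat[of r 1 m] unity_root_eq_1_iff[OF assms, of "int m"] that wt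
      by (auto simp: dest: dvd_imp_le)
    then have "nonneg_walk ?w \<in> word_span (unity_root r 1) (letters ?w) (weight ?w)"
      by (rule nonneg_walk_in_word_span[OF valid])
    then show ?thesis
      unfolding v restrict_plate_eq_nonneg_walk[OF *(1,2,4)] using wt
      by (rule word_span_root_classes)
  qed
  then show ?thesis
    unfolding Pl_def by (intro thin_fun.span_minimal thin_fun.subspace_span) auto
qed

section \<open>The Fourier basis\<close>

lemma sum_eq_inner: "(\<Sum>a\<in>T. x $ a) = (\<chi> i. if i \<in> T then 1 else 0) \<bullet> (x :: real ^ 'n::finite)"
  by (simp add: inner_vec_def if_distrib[of "\<lambda>c. c * _"] sum.If_cases cong: if_cong)

lemma thin_hyperplane_section:
  fixes T :: "'n::finite set"
  assumes "c \<noteq> 0" "T \<noteq> {}" "T \<noteq> UNIV"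
  shows "thin {x :: real ^ 'n. (\<Sum>a\<in>UNIV. x $ a) = c \<and> (\<Sum>a\<in>T. x $ a) = d}"
proof -
  let ?H = "\<lambda>T c. {x :: real ^ 'n. (\<Sum>a\<in>T. x $ a) = c}"
  have H: "?H T c = {x. (\<chi> i. if i \<in> T then 1 else 0) \<bullet> x = c}" for T c
    by (simp add: sum_eq_inner)
  have poly: "polyhedron (?H T c)" and aff: "affine (?H T c)" for T c
    unfolding H by (auto simp: polyhedron_hyperplane affine_hyperplane)
  \<comment> \<open>\<open>c\<close> and 0 differ, so one of them is not \<open>d\<close>. Choosing
    \<open>b\<close> inside or outside \<open>T\<close> accordingly gives a point
    \<open>axis b c\<close> that lies on one hyperplane and misses the other, so the dimension
    drops.\<close>
  obtain b where b: "(if b \<in> T then c else 0) \<noteq> d"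
    using assms by (metis UNIV_eq_I all_not_in_conv)
  have "axis b c \<in> ?H UNIV c" "axis b c \<notin> ?H T d"
    using b by (auto simp: axis_def)
  then have "?H UNIV c \<inter> ?H T d \<subset> ?H UNIV c"
    by blast
  then have "aff_dim (?H UNIV c \<inter> ?H T d) < aff_dim (?H UNIV c)"
    by (intro aff_dim_psubset)
      (simp only: affine_hull_eq[THEN iffD2, OF aff] affine_hull_eq[THEN iffD2, OF affine_Int[OF aff aff]])
  also have "aff_dim (?H UNIV c) = int CARD('n) - 1"
  proof -
    have "(\<chi> i. 1) \<noteq> (0 :: real ^ 'n)"
      by (simp add: vec_eq_iff)
    then show ?thesis
      unfolding H by (subst aff_dim_hyperplane) simp_all
  qed
  finally have "aff_dim (?H UNIV c \<inter> ?H T d) < int CARD('n) - 1" .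
  then show ?thesis
    unfolding thin_def using poly
    by (intro exI[of _ "{?H UNIV c \<inter> ?H T d}"]) auto
qed

text \<open>The difference of two values of a walk is a subset sum minus an integer, so a tie
  between distinct times below \<open>r\<close> puts a point of the simplex here.\<close>

definition walls :: "nat \<Rightarrow> (real ^ 'n::finite) set" where
  "walls r = {x \<in> dilated_simplex r. \<exists>T t. T \<noteq> {} \<and> T \<noteq> UNIV \<and> (\<Sum>a\<in>T. x $ a) = real t}"

lemma thin_Union: "finite I \<Longrightarrow> (\<And>i. i \<in> I \<Longrightarrow> thin (A i)) \<Longrightarrow> thin (\<Union>i\<in>I. A i)"
  by (induction I rule: finite_induct) (auto simp: thin_empty intro: thin_Un)

lemma sum_le_simplex:
  assumes "x \<in> dilated_simplex r"
  shows "(\<Sum>a\<in>T. x $ a) \<le> real r"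
proof -
  have "(\<Sum>a\<in>T. x $ a) \<le> (\<Sum>a\<in>UNIV. x $ a)"
    using assms by (intro sum_mono2) (auto simp: dilated_simplex_def)
  then show ?thesis
    using assms by (simp add: dilated_simplex_def)
qed

lemma thin_walls:
  assumes "r \<ge> 1"
  shows "thin (walls r :: (real ^ 'n::finite) set)"
proof (rule thin_subset)
  let ?I = "{T :: 'n set. T \<noteq> {} \<and> T \<noteq> UNIV} \<times> {..r}"
  show "thin (\<Union>(T, t)\<in>?I. {x :: real ^ 'n. (\<Sum>a\<in>UNIV. x $ a) = real r \<and> (\<Sum>a\<in>T. x $ a) = real t})"
    using assms by (intro thin_Union) (auto intro!: thin_hyperplane_section)
  show "walls r \<subseteq> (\<Union>(T, t)\<in>?I. {x :: real ^ 'n. (\<Sum>a\<in>UNIV. x $ a) = real r \<and> (\<Sum>a\<in>T. x $ a) = real t})"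
  proof
    fix x :: "real ^ 'n" assume "x \<in> walls r"
    then obtain T t where x: "x \<in> dilated_simplex r" and T: "T \<noteq> {}" "T \<noteq> UNIV" "(\<Sum>a\<in>T. x $ a) = real t"
      unfolding walls_def by blast
    then have "t \<le> r"
      using sum_le_simplex[OF x, of T] by simp
    with x T show "x \<in> (\<Union>(T, t)\<in>?I. {x :: real ^ 'n. (\<Sum>a\<in>UNIV. x $ a) = real r \<and> (\<Sum>a\<in>T. x $ a) = real t})"
      by (auto simp: dilated_simplex_def)
  qed
qed

lemma thin_class_eqI:
  assumes "thin A" "\<And>x. x \<notin> A \<Longrightarrow> f x = g x"
  shows "thin_class f = thin_class g"
proof -
  have "thin {x. f x \<noteq> g x}"
    using assms(1) by (rule thin_subset) (use assms(2) in blast)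
  then show ?thesis
    unfolding thin_fun.abs_eq_iff thin_eq_def .
qed

lemma walk_min_props:
  assumes "r \<ge> 1"
  shows "walk_min r f x < r" "\<And>s. s < r \<Longrightarrow> walk f x (walk_min r f x) \<le> walk f x s"
proof -
  obtain t where "t < r" "\<forall>s<r. walk f x t \<le> walk f x s"
    using ex_min_if_finite[of "walk f x ` {..<r}"] assms by (fastforce simp: not_less)
  then have "\<exists>t. t < r \<and> (\<forall>s<r. walk f x t \<le> walk f x s)"
    by blast
  from LeastI_ex[OF this] show "walk_min r f x < r" "\<And>s. s < r \<Longrightarrow> walk f x (walk_min r f x) \<le> walk f x s"
    unfolding walk_min_def by auto
qed

text \<open>A tie makes the sum over \<open>s \<le> f b < t\<close> equal to \<open>t - s\<close>.
  This is positive and less than \<open>r\<close>, so the index set is neither empty nor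
  everything.\<close>

lemma walk_inj_off_walls:
  assumes x: "x \<in> dilated_simplex r" "x \<notin> walls r" and st: "s < t" "t < r"
  shows "walk f x s \<noteq> walk f x t"
proof
  assume eq: "walk f x s = walk f x t"
  let ?T = "{b. s \<le> f b \<and> f b < t}"
  have "{b. f b < t} = {b. f b < s} \<union> ?T" "{b. f b < s} \<inter> ?T = {}"
    using st by auto
  then have "(\<Sum>b\<in>?T. x $ b) = real (t - s)"
    using eq st by (simp add: walk_def sum.union_disjoint of_nat_diff)
  moreover from this have "?T \<noteq> {}"
    using st by (metis diff_is_0_eq of_nat_eq_0_iff not_less sum.empty)
  moreover have "?T \<noteq> UNIV"
  proof
    assume "?T = UNIV"
    then have "real (t - s) = real r"
      using x(1) \<open>(\<Sum>b\<in>?T. x $ b) = real (t - s)\<close> by (simp add: dilated_simplex_def)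
    then show False
      using st by linarith
  qed
  ultimately have "x \<in> walls r"
    using x(1) unfolding walls_def by (intro CollectI conjI exI[of _ ?T] exI[of _ "t - s"])
  then show False
    using x(2) by simp
qed

text \<open>The coordinates with \<open>f b = r - 1\<close> move to the front and lift all values
  alike: the added constant does not depend on \<open>t\<close>. At the wrap-around the coordinate
  total \<open>r\<close> makes up for the drop by \<open>r\<close>.\<close>

lemma walk_rotate:
  assumes "\<forall>b. f b < r" "x \<in> dilated_simplex r" "t < r"
  shows "walk (\<lambda>b. (f b + 1) mod r) x ((t + 1) mod r) = walk f x t + (\<Sum>b | f b = r - 1. x $ b) - 1"
proof (cases "t = r - 1")
  case True
  have "{b. f b < r - 1} \<union> {b. f b = r - 1} = UNIV"
  proof -
    have "f b < r - 1 \<or> f b = r - 1" for b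
      using assms(1)[rule_format, of b] by linarith
    then show ?thesis by blast
  qed
  moreover have "{b. f b < r - 1} \<inter> {b. f b = r - 1} = {}"
    by auto
  ultimately have "(\<Sum>b | f b < r - 1. x $ b) + (\<Sum>b | f b = r - 1. x $ b) = real r"
    using assms(2) by (subst sum.union_disjoint[symmetric]) (simp_all add: dilated_simplex_def)
  then show ?thesis
    using True assms(3) by (simp add: walk_def of_nat_diff)
next
  case False
  then have "{b. (f b + 1) mod r < (t + 1) mod r} = {b. f b < t} \<union> {b. f b = r - 1}"
    using assms(1,3) by (auto simp: mod_Suc)
  moreover have "{b. f b < t} \<inter> {b. f b = r - 1} = {}"
    using assms(3) by auto
  ultimately show ?thesis
    using False assms(3) by (simp add: walk_def sum.union_disjoint)
qed

text \<open>A constant does not move the minimum, and off the walls the minimum is unique, so the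
  choice made by \<open>LEAST\<close> commutes with rotation.\<close>

lemma walk_min_rotate:
  assumes r: "r \<ge> 1" and f: "\<forall>b. f b < r" and x: "x \<in> dilated_simplex r" "x \<notin> walls r"
  shows "walk_min r (\<lambda>b. (f b + 1) mod r) x = (walk_min r f x + 1) mod r"
proof -
  let ?g = "\<lambda>b. (f b + 1) mod r" and ?m = "walk_min r f x"
  have lt: "(?m + 1) mod r < r"
    using r by simp
  have "walk ?g x ((?m + 1) mod r) \<le> walk ?g x s" if s: "s < r" for s
  proof -
    obtain s' where s': "s' < r" "s = (s' + 1) mod r"
    proof
      show "(s + (r - 1)) mod r < r" "s = ((s + (r - 1)) mod r + 1) mod r"
        using r s by (simp_all add: mod_simps)
    qed
    show ?thesis
      unfolding s'(2) walk_rotate[OF f x(1) s'(1)] walk_rotate[OF f x(1) walk_min_props(1)[OF r]]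
      using walk_min_props(2)[OF r s'(1), of f x] by simp
  qed
  then have "walk ?g x ((?m + 1) mod r) = walk ?g x (walk_min r ?g x)"
    using walk_min_props(1)[OF r, of ?g x] walk_min_props(2)[OF r lt, of ?g x] by (intro antisym) auto
  then show ?thesis
    using walk_inj_off_walls[OF x, where f = ?g] walk_min_props(1)[OF r, of ?g x] lt
    by (metis linorder_neqE_nat)
qed

definition root_class :: "nat \<Rightarrow> ('n \<Rightarrow> nat) \<Rightarrow> 'n::finite thin_fun" where
  "root_class r f = thin_class (root_fun r f)"

lemma root_class_rotate:
  assumes r: "r \<ge> 1" and f: "\<forall>b. f b < r"
  shows "root_class r (\<lambda>b. (f b + 1) mod r) = scale_thin_fun (unity_root r 1) (root_class r f)"
  unfolding root_class_def thin_class_scale[symmetric]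
proof (rule thin_class_eqI[OF thin_walls[OF r]])
  fix x :: "real ^ 'a" assume "x \<notin> walls r"
  moreover have "unity_root r (int ((m + 1) mod r)) = unity_root r 1 * unity_root r (int m)" for m
    unfolding unity_root_add[symmetric]
    by (rule unity_root_cong[OF r]) (simp add: zmod_int mod_eq_dvd_iff[symmetric] add.commute)
  ultimately show "root_fun r (\<lambda>b. (f b + 1) mod r) x = unity_root r 1 * root_fun r f x"
    using walk_min_rotate[OF r f] by (simp add: root_fun_def restrict_to_simplex_def)
qed

lemma bij_betw_rotate:
  fixes r :: nat
  assumes "r \<ge> 1"
  shows "bij_betw (\<lambda>f b. (f b + 1) mod r) (UNIV \<rightarrow>\<^sub>E {..<r}) (UNIV \<rightarrow>\<^sub>E {..<r})"
proof -
  have "((a + 1) mod r + (r - 1)) mod r = a" "((a + (r - 1)) mod r + 1) mod r = a" if "a < r" for a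
  proof -
    have "((a + 1) mod r + (r - 1)) mod r = (a + 1 + (r - 1)) mod r"
      "((a + (r - 1)) mod r + 1) mod r = (a + (r - 1) + 1) mod r"
      by (rule mod_add_left_eq)+
    moreover have "a + 1 + (r - 1) = a + r" "a + (r - 1) + 1 = a + r"
      using assms by simp_all
    ultimately show "((a + 1) mod r + (r - 1)) mod r = a" "((a + (r - 1)) mod r + 1) mod r = a"
      using that by (simp_all only: mod_add_self2 mod_less)
  qed
  then show ?thesis
    using assms
    by (intro bij_betwI[where g = "\<lambda>f b. (f b + (r - 1)) mod r"]) (auto simp: fun_eq_iff PiE_iff)
qed

definition fourier_class :: "nat \<Rightarrow> ('n \<Rightarrow> nat) \<Rightarrow> 'n::finite thin_fun" where
  "fourier_class r y = (\<Sum>f\<in>UNIV \<rightarrow>\<^sub>E {..<r}.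
     scale_thin_fun (unity_root r (- (\<Sum>b\<in>UNIV. int (y b) * int (f b)))) (root_class r f))"

text \<open>Reindexing the sum by the rotation multiplies it by the root of unity with exponent
  \<open>?d\<close>, one minus the sum of \<open>y\<close>. If this factor is not 1, the sum is
  0.\<close>

lemma fourier_class_eq_0:
  fixes y :: "'n::finite \<Rightarrow> nat"
  assumes r: "r \<ge> 1" and y: "\<not> [(\<Sum>b\<in>UNIV. y b) = 1] (mod r)"
  shows "fourier_class r y = 0"
proof -
  let ?s = "\<lambda>f :: 'n \<Rightarrow> nat. \<Sum>b\<in>UNIV. int (y b) * int (f b)" and ?F = "UNIV \<rightarrow>\<^sub>E {..<r} :: ('n \<Rightarrow> nat) set"
  let ?d = "1 - int (\<Sum>b\<in>UNIV. y b)"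
  have coeff: "unity_root r (- ?s (\<lambda>b. (f b + 1) mod r)) * unity_root r 1 = unity_root r ?d * unity_root r (- ?s f)" for f
  proof -
    have "int r dvd (\<Sum>b\<in>UNIV. int (y b) * (int ((f b + 1) mod r) - int (f b + 1)))"
      by (intro dvd_sum dvd_mult) (simp add: zmod_int mod_eq_dvd_iff[symmetric])
    also have "(\<Sum>b\<in>UNIV. int (y b) * (int ((f b + 1) mod r) - int (f b + 1))) =
        (?d + - ?s f) - (- ?s (\<lambda>b. (f b + 1) mod r) + 1)"
      by (simp add: algebra_simps sum.distrib sum_subtractf)
    finally show ?thesis
      unfolding unity_root_add[symmetric] by (rule unity_root_cong[OF r, symmetric])
  qed
  have "fourier_class r y = (\<Sum>f\<in>?F. scale_thin_fun (unity_root r (- ?s (\<lambda>b. (f b + 1) mod r)))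
      (root_class r (\<lambda>b. (f b + 1) mod r)))"
    unfolding fourier_class_def by (rule sum.reindex_bij_betw[OF bij_betw_rotate[OF r], symmetric])
  also have "\<dots> = (\<Sum>f\<in>?F. scale_thin_fun (unity_root r (- ?s (\<lambda>b. (f b + 1) mod r)) * unity_root r 1) (root_class r f))"
  proof (rule sum.cong[OF refl])
    fix f assume "f \<in> ?F"
    then have lt: "\<forall>b. f b < r"
      by (simp add: PiE_iff)
    show "scale_thin_fun (unity_root r (- ?s (\<lambda>b. (f b + 1) mod r))) (root_class r (\<lambda>b. (f b + 1) mod r)) =
        scale_thin_fun (unity_root r (- ?s (\<lambda>b. (f b + 1) mod r)) * unity_root r 1) (root_class r f)"
      unfolding root_class_rotate[OF r lt] thin_fun.scale_scale ..
  qed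
  also have "\<dots> = scale_thin_fun (unity_root r ?d) (fourier_class r y)"
    unfolding coeff fourier_class_def by (simp add: thin_fun.scale_sum_right)
  finally have "scale_thin_fun (1 - unity_root r ?d) (fourier_class r y) = 0"
    by (simp add: thin_fun.scale_left_diff_distrib)
  moreover have "unity_root r ?d \<noteq> 1"
  proof
    assume "unity_root r ?d = 1"
    then have "int r dvd ?d"
      using unity_root_eq_1_iff[OF r] by blast
    then have "[int 1 = int (\<Sum>b\<in>UNIV. y b)] (mod int r)"
      by (simp add: cong_iff_dvd_diff)
    then have "[1 = (\<Sum>b\<in>UNIV. y b)] (mod r)"
      unfolding cong_int_iff .
    then show False
      using y by (blast dest: cong_sym)
  qed
  ultimately show ?thesis
    by simp
qed

text \<open>Fourier inversion on (Z/r)^n: orthogonality isolates the summand \<open>g = f\<close>,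
  since values below \<open>r\<close> that agree modulo \<open>r\<close> are equal.\<close>

lemma root_class_eq_sum_fourier_class:
  fixes f :: "'n::finite \<Rightarrow> nat"
  assumes r: "r \<ge> 1" and f: "f \<in> UNIV \<rightarrow>\<^sub>E {..<r}"
  shows "root_class r f = scale_thin_fun (1 / of_nat r ^ CARD('n))
    (\<Sum>y\<in>UNIV \<rightarrow>\<^sub>E {..<r}. scale_thin_fun (unity_root r (\<Sum>b\<in>UNIV. int (y b) * int (f b))) (fourier_class r y))"
proof -
  let ?F = "UNIV \<rightarrow>\<^sub>E {..<r} :: ('n \<Rightarrow> nat) set"
  have fin: "finite ?F"
    by (simp add: finite_PiE)
  have orth: "(\<Sum>y\<in>?F. unity_root r (\<Sum>b\<in>UNIV. int (y b) * int (f b)) * unity_root r (- (\<Sum>b\<in>UNIV. int (y b) * int (g b)))) =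
      (if g = f then of_nat r ^ CARD('n) else 0)" if "g \<in> ?F" for g
  proof -
    have "int r dvd int (f b) - int (g b) \<longleftrightarrow> g b = f b" for b
    proof -
      have "f b < r" "g b < r"
        using f that by (auto simp: PiE_iff)
      then show ?thesis
        by (metis cong_iff_dvd_diff cong_int_iff cong_less_modulus_unique_nat cong_refl)
    qed
    then have "(\<Sum>y\<in>?F. unity_root r (\<Sum>b\<in>UNIV. (int (f b) - int (g b)) * int (y b))) =
        (if g = f then of_nat r ^ CARD('n) else 0)"
      by (subst sum_prod_unity_root[OF r]) (auto simp: fun_eq_iff)
    then show ?thesis
      unfolding unity_root_add[symmetric] by (simp add: algebra_simps sum_subtractf)
  qed
  have "(\<Sum>y\<in>?F. scale_thin_fun (unity_root r (\<Sum>b\<in>UNIV. int (y b) * int (f b))) (fourier_class r y)) =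
      (\<Sum>y\<in>?F. \<Sum>g\<in>?F. scale_thin_fun (unity_root r (\<Sum>b\<in>UNIV. int (y b) * int (f b)) *
        unity_root r (- (\<Sum>b\<in>UNIV. int (y b) * int (g b)))) (root_class r g))"
    by (simp add: fourier_class_def thin_fun.scale_sum_right)
  also have "\<dots> = (\<Sum>g\<in>?F. scale_thin_fun (\<Sum>y\<in>?F. unity_root r (\<Sum>b\<in>UNIV. int (y b) * int (f b)) *
        unity_root r (- (\<Sum>b\<in>UNIV. int (y b) * int (g b)))) (root_class r g))"
    by (subst sum.swap) (simp add: thin_fun.scale_sum_left)
  also have "\<dots> = (\<Sum>g\<in>?F. if g = f then scale_thin_fun (of_nat r ^ CARD('n)) (root_class r f) else 0)"
    using orth by (intro sum.cong) auto
  also have "\<dots> = scale_thin_fun (of_nat r ^ CARD('n)) (root_class r f)"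
    using fin f by (simp add: sum.delta)
  finally show ?thesis
    using r by simp
qed

definition fourier_index :: "nat \<Rightarrow> ('n::finite \<Rightarrow> nat) set" where
  "fourier_index r = {y \<in> UNIV \<rightarrow>\<^sub>E {..<r}. [(\<Sum>b\<in>UNIV. y b) = 1] (mod r)}"

lemma root_classes_subset_span:
  assumes r: "r \<ge> 1"
  shows "root_classes r \<subseteq> thin_fun.span (fourier_class r ` (fourier_index r :: ('n::finite \<Rightarrow> nat) set))"
proof
  fix v :: "'n thin_fun" assume "v \<in> root_classes r"
  then obtain f where v: "v = root_class r f" and f: "f \<in> UNIV \<rightarrow>\<^sub>E {..<r}"
    by (auto simp: root_classes_def root_class_def PiE_iff)
  have "fourier_class r y \<in> thin_fun.span (fourier_class r ` fourier_index r)" if "y \<in> UNIV \<rightarrow>\<^sub>E {..<r}" for y :: "'n \<Rightarrow> nat"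
    using that fourier_class_eq_0[OF r, of y]
    by (cases "y \<in> fourier_index r") (auto simp: fourier_index_def thin_fun.span_zero intro: thin_fun.span_base)
  then show "v \<in> thin_fun.span (fourier_class r ` fourier_index r)"
    unfolding v root_class_eq_sum_fourier_class[OF r f]
    by (intro thin_fun.span_scale thin_fun.span_sum) auto
qed

lemma card_fourier_index:
  assumes "r \<ge> 1"
  shows "card (fourier_index r :: ('n::finite \<Rightarrow> nat) set) = r ^ (CARD('n) - 1)"
  using card_linear_cong_1[OF assms, of "UNIV :: 'n set" "\<lambda>_. 1"]
  by (simp add: fourier_index_def)

section \<open>Permutations acting on root classes and Fourier classes\<close>

lemma walk_permute:
  assumes "\<sigma> permutes UNIV"
  shows "walk f (\<chi> i. x $ \<sigma> i) t = walk (f \<circ> inv \<sigma>) x t"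
proof -
  have "{b. (f \<circ> inv \<sigma>) b < t} = \<sigma> ` {b. f b < t}"
    using permutes_inverses[OF assms] by (auto simp: image_iff) metis
  then show ?thesis
    using permutes_inj_on[OF assms] by (simp add: walk_def sum.reindex)
qed

lemma act_root_class:
  assumes "\<sigma> permutes UNIV"
  shows "act \<sigma> (root_class r f) = root_class r (f \<circ> inv \<sigma>)"
proof -
  have "act_fun \<sigma> (root_fun r f) = root_fun r (f \<circ> inv \<sigma>)"
    unfolding root_fun_def act_fun_restrict[OF assms]
    by (simp add: act_fun_def walk_min_def walk_permute[OF assms])
  then show ?thesis
    using assms by (simp add: root_class_def act.abs_eq)
qed

lemma act_sum: "act \<sigma> (\<Sum>i\<in>I. scale_thin_fun (c i) (v i)) = (\<Sum>i\<in>I. scale_thin_fun (c i) (act \<sigma> (v i)))"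
proof (induction I rule: infinite_finite_induct)
  case (infinite I)
  then show ?case
    using act_scale[of \<sigma> 0 0] by simp
next
  case empty
  then show ?case
    using act_scale[of \<sigma> 0 0] by simp
qed (simp add: act_add act_scale)

lemma bij_betw_comp_permutes:
  fixes \<sigma> :: "'n \<Rightarrow> 'n"
  assumes "\<sigma> permutes UNIV"
  shows "bij_betw (\<lambda>f. f \<circ> \<sigma>) (UNIV \<rightarrow>\<^sub>E B) (UNIV \<rightarrow>\<^sub>E B)"
  using permutes_inverses[OF assms]
  by (intro bij_betwI[where g = "\<lambda>f. f \<circ> inv \<sigma>"]) (auto simp: fun_eq_iff PiE_iff)

lemma act_fourier_class:
  assumes \<sigma>: "\<sigma> permutes UNIV"
  shows "act \<sigma> (fourier_class r y) = fourier_class r (y \<circ> inv \<sigma>)"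
proof -
  have s: "(\<Sum>b\<in>UNIV. int (y b) * int ((f \<circ> \<sigma>) b)) = (\<Sum>b\<in>UNIV. int ((y \<circ> inv \<sigma>) b) * int (f b))" for f
    using sum.permute[OF \<sigma>, of "\<lambda>b. int ((y \<circ> inv \<sigma>) b) * int (f b)"] permutes_inverses[OF \<sigma>]
    by (simp add: o_def)
  have c: "f \<circ> \<sigma> \<circ> inv \<sigma> = f" for f :: "'a \<Rightarrow> nat"
    using permutes_inverses[OF \<sigma>] by (simp add: fun_eq_iff)
  have "act \<sigma> (fourier_class r y) = (\<Sum>f\<in>UNIV \<rightarrow>\<^sub>E {..<r}.
     scale_thin_fun (unity_root r (- (\<Sum>b\<in>UNIV. int (y b) * int (f b)))) (root_class r (f \<circ> inv \<sigma>)))"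
    unfolding fourier_class_def act_sum act_root_class[OF \<sigma>] ..
  also have "\<dots> = fourier_class r (y \<circ> inv \<sigma>)"
    unfolding fourier_class_def s[symmetric]
    by (subst sum.reindex_bij_betw[OF bij_betw_comp_permutes[OF \<sigma>], symmetric]) (simp add: c)
  finally show ?thesis .
qed

section \<open>Test points\<close>

text \<open>
  The plate of \<open>f\<close> with \<open>f o0 = 0\<close> is written in terms of \<open>h = r - f\<close>, by passing to complements.
\<close>

definition parking :: "nat \<Rightarrow> ('n \<Rightarrow> nat) \<Rightarrow> real ^ 'n::finite \<Rightarrow> bool" where
  "parking r h x \<longleftrightarrow> (\<forall>u\<in>{1..<r}. (\<Sum>b | h b \<le> u. x $ b) \<le> real u)"

text \<open>Telescoping: the subtracted maximum is the predecessor of \<open>v\<close> in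
  \<open>A\<close>, or 0.\<close>

lemma sum_gaps:
  fixes A :: "nat set"
  assumes "finite A"
  shows "(\<Sum>v\<in>A. v - Max (insert 0 {w \<in> A. w < v})) = Max (insert 0 A)"
  using assms
proof (induction A rule: finite_linorder_max_induct)
  case (insert b A)
  have "{w \<in> insert b A. w < v} = {w \<in> A. w < v}" if "v \<in> A" for v
    using insert(2) that by force
  moreover have "{w \<in> insert b A. w < b} = A" "b \<notin> A"
    using insert(2) by auto
  moreover have "Max (insert 0 A) \<le> b"
    using insert(1,2) by (auto simp: less_imp_le)
  moreover have "Max (insert 0 (insert b A)) = b"
    using insert(1,2) by (intro Max_eqI) (auto simp: less_imp_le)
  ultimately show ?case
    using insert(1,3) by simp
qed simp

text \<open>The terms of \<open>R\<close> and \<open>insert a R\<close> cancel.\<close>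

lemma alternating_sum_Pow_eq_0:
  fixes F :: "'a set \<Rightarrow> 'b::comm_ring_1"
  assumes "finite A" "a \<in> A" "\<And>R. R \<subseteq> A - {a} \<Longrightarrow> F (insert a R) = F R"
  shows "(\<Sum>R\<in>Pow A. (- 1) ^ card R * F R) = 0"
proof -
  let ?B = "A - {a}"
  have A: "A = insert a ?B"
    using assms(2) by auto
  have "(\<Sum>R\<in>Pow A. (- 1) ^ card R * F R) =
      (\<Sum>R\<in>Pow ?B. (- 1) ^ card R * F R) + (\<Sum>R\<in>insert a ` Pow ?B. (- 1) ^ card R * F R)"
    using assms(1) by (subst A, subst Pow_insert, subst sum.union_disjoint) auto
  also have "(\<Sum>R\<in>insert a ` Pow ?B. (- 1) ^ card R * F R) = (\<Sum>R\<in>Pow ?B. (- 1) ^ card (insert a R) * F (insert a R))"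
    by (subst sum.reindex) (auto simp: inj_on_def)
  also have "\<dots> = (\<Sum>R\<in>Pow ?B. - ((- 1) ^ card R * F R))"
  proof (rule sum.cong[OF refl])
    fix R assume "R \<in> Pow ?B"
    then have "R \<subseteq> A - {a}" "finite R" "a \<notin> R"
      using assms(1) by (auto intro: finite_subset)
    then show "(- 1) ^ card (insert a R) * F (insert a R) = - ((- 1) ^ card R * F R)"
      using assms(3)[of R] by simp
  qed
  finally show ?thesis
    by (simp add: sum_negf)
qed

lemma sum_power2_less:
  fixes k :: "'a \<Rightarrow> nat"
  assumes "finite T" "inj_on k T" "\<And>b. b \<in> T \<Longrightarrow> k b < m"
  shows "(\<Sum>b\<in>T. 2 ^ k b) < (2 ^ m :: real)"
proof -
  have "(\<Sum>b\<in>T. 2 ^ k b) = (\<Sum>i\<in>k ` T. 2 ^ i :: real)"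
    using assms(2) by (simp add: sum.reindex)
  also have "\<dots> \<le> (\<Sum>i<m. 2 ^ i)"
    using assms(3) by (intro sum_mono2) auto
  also have "\<dots> < 2 ^ m"
    by (simp add: geometric_sum)
  finally show ?thesis .
qed

text \<open>\<open>o0\<close>, on the top level, will absorb the total; \<open>idx\<close> is an
  arbitrary numbering that breaks ties between coordinates on the same level.\<close>

locale test_points =
  fixes r :: nat and h :: "'n::finite \<Rightarrow> nat" and o0 :: 'n and idx :: "'n \<Rightarrow> nat" and K :: nat
  assumes h_o0: "h o0 = r" and h_pos: "1 \<le> h b" and h_le: "h b \<le> r"
    and idx_inj: "inj idx" and idx_less: "idx b < K"
begin

text \<open>
  The test points lie near a vertex where all inequalities defining \<open>parking r h\<close> are tight. They
  differ by the signs of infinitesimals of different orders of magnitude, one for each level of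
  \<open>h\<close> below \<open>r\<close>, so that the alternating sum over these signs sees only the
  functions that jump across all those inequalities.
\<close>

definition key :: "'n \<Rightarrow> nat" where
  "key b = h b * K + idx b"

text \<open>On each level below \<open>r\<close>, the coordinate of largest key. Its sign alone
  decides the sign of the perturbation summed over the sublevel set.\<close>

definition reps :: "'n set" where
  "reps = {b. h b < r \<and> (\<forall>c. h c = h b \<longrightarrow> idx c \<le> idx b)}"

text \<open>The vertex: the representative of a level carries the gap to the previous level, so the
  sum over a sublevel set is the highest level in it.\<close>

definition rough :: "'n \<Rightarrow> nat" where
  "rough b = (if b \<in> reps then h b - Max (insert 0 {v \<in> range h. v < h b}) else 0)"

text \<open>Keys are distinct and below \<open>(r + 1) * K\<close>, so with this denominator every
  sum of perturbations is smaller than 1 in absolute value.\<close>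

definition tiny :: "'n set \<Rightarrow> 'n \<Rightarrow> real" where
  "tiny R b = (if b \<in> R then - 1 else 1) * 2 ^ key b / 2 ^ ((r + 1) * K)"

definition point :: "'n set \<Rightarrow> real ^ 'n" where
  "point R = (\<chi> b. if b = o0 then real r - (\<Sum>c\<in>- {o0}. real (rough c) + tiny R c)
     else real (rough b) + tiny R b)"

lemma key_less_iff: "key b < key c \<longleftrightarrow> h b < h c \<or> h b = h c \<and> idx b < idx c"
proof -
  have *: "key b < key c" if "h b < h c" for b c
  proof -
    have "key b < (h b + 1) * K"
      using idx_less[of b] by (simp add: key_def)
    also have "\<dots> \<le> h c * K"
      using that by (intro mult_le_mono1) simp
    finally show ?thesis
      by (simp add: key_def)
  qed
  then show ?thesis
  proof (cases "h b" "h c" rule: linorder_cases)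
    case equal
    then show ?thesis by (simp add: key_def)
  qed (use *[of b c] *[of c b] in \<open>simp_all add: not_less less_imp_le\<close>)
qed

lemma inj_key: "inj key"
proof (rule injI)
  fix b c assume "key b = key c"
  then have "\<not> key b < key c" "\<not> key c < key b"
    by simp_all
  then show "b = c"
    unfolding key_less_iff using injD[OF idx_inj, of b c] by (metis linorder_neqE_nat)
qed

lemma key_bound: "key b < (r + 1) * K"
proof -
  have "key b < (h b + 1) * K"
    using idx_less[of b] by (simp add: key_def)
  also have "\<dots> \<le> (r + 1) * K"
    using h_le[of b] by (intro mult_le_mono1) simp
  finally show ?thesis .
qed

lemma abs_sum_tiny: "\<bar>\<Sum>b\<in>T. tiny R b\<bar> < 1"
proof -
  have "\<bar>\<Sum>b\<in>T. tiny R b\<bar> \<le> (\<Sum>b\<in>T. \<bar>tiny R b\<bar>)"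
    by (rule sum_abs)
  also have "\<dots> = (\<Sum>b\<in>T. 2 ^ key b) / 2 ^ ((r + 1) * K)"
    unfolding sum_divide_distrib by (intro sum.cong) (auto simp: tiny_def abs_mult)
  also have "\<dots> < 1"
    using sum_power2_less[of T key "(r + 1) * K"] key_bound inj_key
    by (simp add: inj_on_subset[OF inj_key] del: add_mult_distrib)
  finally show ?thesis .
qed

text \<open>The term of largest key outweighs all others together, since these are distinct smaller
  powers of two.\<close>

lemma sum_tiny_sign:
  assumes d: "d \<in> T" "\<And>b. b \<in> T \<Longrightarrow> key b \<le> key d"
  shows "(\<Sum>b\<in>T. tiny R b) < 0 \<longleftrightarrow> d \<in> R" "0 < (\<Sum>b\<in>T. tiny R b) \<longleftrightarrow> d \<notin> R"
proof -
  let ?M = "2 ^ ((r + 1) * K) :: real"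
  have "\<bar>\<Sum>b\<in>T - {d}. tiny R b\<bar> \<le> (\<Sum>b\<in>T - {d}. \<bar>tiny R b\<bar>)"
    by (rule sum_abs)
  also have "\<dots> = (\<Sum>b\<in>T - {d}. 2 ^ key b) / ?M"
    unfolding sum_divide_distrib by (intro sum.cong) (auto simp: tiny_def abs_mult)
  also have "\<dots> < 2 ^ key d / ?M"
  proof -
    have "key b < key d" if "b \<in> T - {d}" for b
      using d(2)[of b] that injD[OF inj_key, of b d] by (auto simp: order_less_le)
    then show ?thesis
      by (intro divide_strict_right_mono sum_power2_less) (auto intro: inj_on_subset[OF inj_key])
  qed
  finally have "\<bar>\<Sum>b\<in>T - {d}. tiny R b\<bar> < 2 ^ key d / ?M" .
  moreover have "(\<Sum>b\<in>T. tiny R b) = tiny R d + (\<Sum>b\<in>T - {d}. tiny R b)"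
    using d(1) by (simp add: sum.remove)
  ultimately show "(\<Sum>b\<in>T. tiny R b) < 0 \<longleftrightarrow> d \<in> R" "0 < (\<Sum>b\<in>T. tiny R b) \<longleftrightarrow> d \<notin> R"
    by (auto simp: tiny_def abs_if split: if_splits)
qed

lemma ex_max_key:
  assumes "T \<noteq> {}"
  obtains d where "d \<in> T" "\<And>b. b \<in> T \<Longrightarrow> key b \<le> key d"
proof -
  have "Max (key ` T) \<in> key ` T"
    using assms by (intro Max_in) auto
  then obtain d where "d \<in> T" "key d = Max (key ` T)"
    by auto
  then show thesis
    by (intro that[of d]) auto
qed

lemma sum_tiny_neq_0: "T \<noteq> {} \<Longrightarrow> (\<Sum>b\<in>T. tiny R b) \<noteq> 0"
  using sum_tiny_sign[of _ T R] by (metis ex_max_key less_irrefl)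

lemma reps_unique: "b \<in> reps \<Longrightarrow> c \<in> reps \<Longrightarrow> h b = h c \<Longrightarrow> b = c"
  unfolding reps_def using injD[OF idx_inj, of b c] by (auto intro: antisym)

lemma ex_rep:
  assumes "h c < r"
  obtains b where "b \<in> reps" "h b = h c"
proof -
  obtain b where b: "b \<in> {b. h b = h c}" "\<And>d. d \<in> {b. h b = h c} \<Longrightarrow> key d \<le> key b"
    using ex_max_key[of "{b. h b = h c}"] by blast
  then show thesis
    using assms by (intro that[of b]) (auto simp: reps_def key_def)
qed

lemma rough_sum:
  assumes "u < r"
  shows "(\<Sum>b | b \<in> reps \<and> h b \<le> u. rough b) = Max (insert 0 {v \<in> range h. v \<le> u})"
proof -
  let ?A = "{v \<in> range h. v \<le> u}" and ?B = "{b. b \<in> reps \<and> h b \<le> u}"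
  have A: "?A = h ` ?B"
    using assms ex_rep by (auto simp: image_iff) (metis le_less_trans)
  have inj: "inj_on h ?B"
    using reps_unique by (auto intro: inj_onI)
  have "(\<Sum>v\<in>?A. v - Max (insert 0 {w \<in> ?A. w < v})) = (\<Sum>b\<in>?B. h b - Max (insert 0 {w \<in> ?A. w < h b}))"
    unfolding A sum.reindex[OF inj] by (simp only: o_def)
  also have "\<dots> = (\<Sum>b\<in>?B. rough b)"
  proof (rule sum.cong[OF refl])
    fix b assume b: "b \<in> ?B"
    then have "{w \<in> ?A. w < h b} = {w \<in> range h. w < h b}"
      by auto
    then show "h b - Max (insert 0 {w \<in> ?A. w < h b}) = rough b"
      using b by (simp add: rough_def)
  qed
  finally show ?thesis
    using sum_gaps[of ?A] by simp
qed

lemma rough_sum_restrict: "(\<Sum>b\<in>T. rough b) = (\<Sum>b | b \<in> reps \<and> b \<in> T. rough b)"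
  by (rule sum.mono_neutral_right) (auto simp: rough_def)

lemma rough_sum_level:
  assumes "u < r"
  shows "(\<Sum>b | h b \<le> u. rough b) = Max (insert 0 {v \<in> range h. v \<le> u})"
  using rough_sum[OF assms] rough_sum_restrict[of "{b. h b \<le> u}"] by simp

lemma rough_sum_le: "u < r \<Longrightarrow> (\<Sum>b | h b \<le> u. rough b) \<le> u"
  by (simp add: rough_sum_level)

lemma rough_sum_rep:
  assumes "b \<in> reps"
  shows "(\<Sum>c | c \<in> reps \<and> h c \<le> h b. rough c) = h b"
proof -
  have "h b < r"
    using assms by (simp add: reps_def)
  moreover have "Max (insert 0 {v \<in> range h. v \<le> h b}) = h b"
    by (intro Max_eqI) auto
  ultimately show ?thesis
    using rough_sum[of "h b"] by simp
qed

lemma sum_point: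
  assumes "o0 \<notin> T"
  shows "(\<Sum>b\<in>T. point R $ b) = real (\<Sum>b\<in>T. rough b) + (\<Sum>b\<in>T. tiny R b)"
proof -
  have "(\<Sum>b\<in>T. point R $ b) = (\<Sum>b\<in>T. real (rough b) + tiny R b)"
    using assms by (intro sum.cong) (auto simp: point_def)
  then show ?thesis
    by (simp add: sum.distrib)
qed

lemma sum_point_UNIV: "(\<Sum>b\<in>UNIV. point R $ b) = real r"
proof -
  have "(\<Sum>b\<in>UNIV. point R $ b) = point R $ o0 + (\<Sum>b\<in>- {o0}. point R $ b)"
    by (simp add: sum.remove Compl_eq_Diff_UNIV)
  also have "(\<Sum>b\<in>- {o0}. point R $ b) = (\<Sum>b\<in>- {o0}. real (rough b) + tiny R b)"
    by (intro sum.cong) (auto simp: point_def)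
  finally show ?thesis
    by (simp add: point_def)
qed

text \<open>A representative has a gap of at least 1, more than any perturbation. Other coordinates
  except \<open>o0\<close> have a positive perturbation, because \<open>R\<close> contains only
  representatives. For \<open>o0\<close>, the gaps subtracted add up to at most
  \<open>r - 1\<close>.\<close>

lemma point_pos:
  assumes "R \<subseteq> reps"
  shows "0 < point R $ b"
proof (cases "b = o0")
  case True
  have r: "1 \<le> r"
    using h_pos[of o0] h_o0 by simp
  have "(\<Sum>c\<in>- {o0}. rough c) = (\<Sum>c | c \<in> reps \<and> c \<in> - {o0}. rough c)"
    by (rule rough_sum_restrict)
  also have "{c. c \<in> reps \<and> c \<in> - {o0}} = {c. c \<in> reps \<and> h c \<le> r - 1}"
    using h_o0 by (auto simp: reps_def)
  also have "(\<Sum>c | c \<in> reps \<and> h c \<le> r - 1. rough c) \<le> r - 1"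
    using rough_sum_restrict[of "{c. h c \<le> r - 1}"] rough_sum_le[of "r - 1"] r by simp
  finally have "real (\<Sum>c\<in>- {o0}. rough c) \<le> real r - 1"
    using r by linarith
  then show ?thesis
    using abs_sum_tiny[of R "- {o0}"] True by (simp add: point_def sum.distrib)
next
  case False
  have tiny: "\<bar>tiny R b\<bar> < 1"
    using abs_sum_tiny[of R "{b}"] by simp
  show ?thesis
  proof (cases "b \<in> reps")
    case True
    have "Max (insert 0 {v \<in> range h. v < h b}) < h b"
      using h_pos[of b] by (subst Max_less_iff) auto
    then have "1 \<le> rough b"
      unfolding rough_def using True by (simp only: if_True Suc_le_eq One_nat_def zero_less_diff)
    then have "1 \<le> real (rough b)"
      by simp
    then show ?thesis
      using tiny False by (simp add: point_def)
  next
    case False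
    then have "0 < tiny R b"
      using assms by (auto simp: tiny_def)
    then show ?thesis
      using \<open>b \<noteq> o0\<close> by (simp add: point_def)
  qed
qed

text \<open>A nonempty sum that avoids \<open>o0\<close> is an integer plus a nonzero perturbation
  smaller than 1. If \<open>o0\<close> occurs, the complement is used.\<close>

lemma sum_point_not_nat:
  assumes "T \<noteq> {}" "T \<noteq> UNIV"
  shows "(\<Sum>b\<in>T. point R $ b) \<noteq> real t"
proof -
  have *: "(\<Sum>b\<in>T. point R $ b) \<noteq> of_int t" if "o0 \<notin> T" "T \<noteq> {}" for T t
  proof
    assume "(\<Sum>b\<in>T. point R $ b) = of_int t"
    then have eq: "(\<Sum>b\<in>T. tiny R b) = of_int (t - int (\<Sum>b\<in>T. rough b))"
      using sum_point[OF that(1), of R] by simp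
    then have "\<bar>of_int (t - int (\<Sum>b\<in>T. rough b)) :: real\<bar> < 1"
      using abs_sum_tiny[of R T] by simp
    then have "t - int (\<Sum>b\<in>T. rough b) = 0"
      by linarith
    then show False
      using eq sum_tiny_neq_0[OF that(2), of R] by simp
  qed
  show ?thesis
  proof (cases "o0 \<in> T")
    case True
    have "(\<Sum>b\<in>T. point R $ b) + (\<Sum>b\<in>- T. point R $ b) = (\<Sum>b\<in>T \<union> - T. point R $ b)"
      by (rule sum.union_disjoint[symmetric]) auto
    also have "T \<union> - T = UNIV"
      by blast
    finally have "(\<Sum>b\<in>- T. point R $ b) = real r - (\<Sum>b\<in>T. point R $ b)"
      using sum_point_UNIV[of R] by simp
    moreover have "(\<Sum>b\<in>- T. point R $ b) \<noteq> of_int (int r - int t)"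
      using True assms by (intro *) auto
    ultimately show ?thesis
      by auto
  next
    case False
    then show ?thesis
      using *[of T "int t"] assms by simp
  qed
qed

text \<open>Adding \<open>b\<close> to \<open>R\<close> lowers the sums, so it can only repair
  violated inequalities. At a repaired one the integer part is tight and the decisive sign is that
  of \<open>b\<close>.\<close>

lemma parking_flip:
  assumes g: "g o0 = r" "\<And>b. 1 \<le> g b"
    and R: "b \<notin> R" and neq: "parking r g (point (insert b R)) \<noteq> parking r g (point R)"
  obtains u where "u \<in> range g" "1 \<le> u" "u < r" "(\<Sum>c | g c \<le> u. rough c) = u" "g b \<le> u"
    "\<And>c. g c \<le> u \<Longrightarrow> key c \<le> key b"
proof -
  let ?T = "\<lambda>u. {c. g c \<le> u}"
  let ?m = "\<lambda>R u. \<Sum>c\<in>?T u. point R $ c"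
  have o0: "o0 \<notin> ?T u" if "u < r" for u
    using that g(1) by simp
  have tiny_mono: "tiny (insert b R) c \<le> tiny R c" for c
    by (auto simp: tiny_def)
  then have mono: "?m (insert b R) u \<le> ?m R u" if "u < r" for u
    unfolding sum_point[OF o0[OF that]] by (intro add_left_mono sum_mono)
  then have park: "parking r g (point R) \<Longrightarrow> parking r g (point (insert b R))"
    unfolding parking_def by (meson atLeastLessThan_iff order_trans)
  with neq have pk: "\<not> parking r g (point R)" "parking r g (point (insert b R))"
    by auto
  then have ex: "\<exists>u. 1 \<le> u \<and> u < r \<and> real u < ?m R u"
    unfolding parking_def by (auto simp: not_le)
  \<comment> \<open>The least violated level is a value of \<open>g\<close>; otherwise its sublevel
    set would be that of \<open>u - 1\<close>, where the bound is even smaller.\<close>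
  define u where "u = (LEAST u. 1 \<le> u \<and> u < r \<and> real u < ?m R u)"
  have u: "1 \<le> u" "u < r" "real u < ?m R u"
    using LeastI_ex[OF ex] unfolding u_def by auto
  have least: "\<not> (1 \<le> v \<and> v < r \<and> real v < ?m R v)" if "v < u" for v
    using that unfolding u_def by (rule not_less_Least)
  have "u \<in> range g"
  proof (rule ccontr)
    assume "u \<notin> range g"
    then have "g c \<le> u \<longleftrightarrow> g c \<le> u - 1" for c
      using u(1) by (metis Suc_pred' le_Suc_eq rangeI less_le_trans zero_less_one)
    then have eq: "?T u = ?T (u - 1)"
      by auto
    show False
    proof (cases "u = 1")
      case True
      then have "?T u = {}"
        unfolding eq using g(2) by (auto simp: not_le Suc_le_eq)
      then show False
        using u(3) by simp
    next
      case False
      then show False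
        using least[of "u - 1"] u unfolding eq by (auto simp: of_nat_diff)
    qed
  qed
  have le: "?m (insert b R) u \<le> real u"
    using pk(2) u unfolding parking_def by simp
  have rough: "(\<Sum>c\<in>?T u. rough c) = u"
  proof -
    \<comment> \<open>The sums for \<open>R\<close> and \<open>insert b R\<close> lie on both sides
      of \<open>u\<close>, and each is within 1 of the integer part.\<close>
    have "real u < real (\<Sum>c\<in>?T u. rough c) + 1" "real (\<Sum>c\<in>?T u. rough c) < real u + 1"
      using u(3) le abs_sum_tiny[of R "?T u"] abs_sum_tiny[of "insert b R" "?T u"]
      unfolding sum_point[OF o0[OF u(2)]] by linarith+
    then show ?thesis
      by linarith
  qed
  have T_ne: "?T u \<noteq> {}"
    using u(1) rough by (metis not_one_le_zero sum.empty)
  obtain d where d: "d \<in> ?T u" "\<And>c. c \<in> ?T u \<Longrightarrow> key c \<le> key d"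
    using ex_max_key[OF T_ne] by metis
  have "0 < (\<Sum>c\<in>?T u. tiny R c)" "\<not> 0 < (\<Sum>c\<in>?T u. tiny (insert b R) c)"
    using u(3) le unfolding sum_point[OF o0[OF u(2)]] rough by simp_all
  then have "d \<notin> R" "d \<in> insert b R"
    using sum_tiny_sign(2)[OF d, of R] sum_tiny_sign(2)[OF d, of "insert b R"] by auto
  then have "d = b"
    by simp
  with d show thesis
    using that[OF \<open>u \<in> range g\<close> u(1,2) rough] by simp
qed

text \<open>Iterated difference of the indicator \<open>parking r g\<close> around the vertex of
  \<open>h\<close>, one difference for each representative.\<close>

definition alternating :: "('n \<Rightarrow> nat) \<Rightarrow> complex" where
  "alternating g = (\<Sum>R\<in>Pow reps. (- 1) ^ card R * (if parking r g (point R) then 1 else 0))"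

text \<open>By cancellation in pairs, every representative \<open>b\<close> must flip
  \<open>parking r g\<close> for some \<open>R\<close>. The tight level that
  \<open>parking_flip\<close> then yields has to be \<open>h b\<close>, because its sublevel set
  contains exactly the representatives up to \<open>b\<close>.\<close>

lemma alternating_neq_0:
  assumes g: "g o0 = r" "\<And>b. 1 \<le> g b" and nz: "alternating g \<noteq> 0" and b: "b \<in> reps"
  shows "h b \<in> range g" "g c \<le> h b \<Longrightarrow> h c \<le> h b"
proof -
  have ex: "\<exists>u\<in>range g. 1 \<le> u \<and> u < r \<and> (\<Sum>c | g c \<le> u. rough c) = u \<and> g b \<le> u \<and> (\<forall>c. g c \<le> u \<longrightarrow> key c \<le> key b)"
    if b: "b \<in> reps" for b
  proof -
    have "\<exists>R\<subseteq>reps - {b}. parking r g (point (insert b R)) \<noteq> parking r g (point R)"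
    proof (rule ccontr)
      assume "\<not> ?thesis"
      then have "alternating g = 0"
        unfolding alternating_def using b by (intro alternating_sum_Pow_eq_0[of _ b]) auto
      with nz show False ..
    qed
    then obtain R where R: "R \<subseteq> reps - {b}" "parking r g (point (insert b R)) \<noteq> parking r g (point R)"
      by blast
    have "b \<notin> R" using R(1) by blast
    from parking_flip[OF g this R(2)] show ?thesis
      by metis
  qed
  obtain u where u: "u \<in> range g" "(\<Sum>c | g c \<le> u. rough c) = u" "g b \<le> u" "\<And>c. g c \<le> u \<Longrightarrow> key c \<le> key b"
    using ex[OF b] by blast
  have le: "h c \<le> h b" if "g c \<le> u" for c
    using u(4)[OF that] key_less_iff[of b c] by (metis not_less)
  have "g c \<le> u" if c: "c \<in> reps" "h c \<le> h b" for c
  proof (cases "c = b")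
    case False
    then have "h c < h b"
      using c reps_unique[OF c(1) b] by (auto simp: order_less_le)
    then have key: "key c < key b"
      by (simp add: key_less_iff)
    \<comment> \<open>\<open>c\<close> has a tight level \<open>v\<close> of its own. No key in that
      sublevel set exceeds \<open>key c\<close>, so \<open>b\<close> is not in it, and
      \<open>g c \<le> v < g b \<le> u\<close>.\<close>
    obtain v where v: "g c \<le> v" "\<And>d. g d \<le> v \<Longrightarrow> key d \<le> key c"
      using ex[OF c(1)] by blast
    then have "\<not> g b \<le> v"
      using key by (metis not_less)
    then show ?thesis
      using u(3) v(1) by simp
  qed (use u in simp)
  then have "{c. c \<in> reps \<and> c \<in> {c. g c \<le> u}} = {c. c \<in> reps \<and> h c \<le> h b}"
    using le by auto
  then have "u = h b"
    using u(2) rough_sum_restrict[of "{c. g c \<le> u}"] rough_sum_rep[OF b] by simp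
  with u(1) le show "h b \<in> range g" "g c \<le> h b \<Longrightarrow> h c \<le> h b"
    by auto
qed

text \<open>At the level of a representative the integer part is tight, so the inequality there
  holds iff its sign is negative. In every nonempty sublevel set below \<open>r\<close> the largest
  key belongs to a representative.\<close>

lemma parking_self:
  assumes "R \<subseteq> reps"
  shows "parking r h (point R) \<longleftrightarrow> R = reps"
proof
  assume park: "parking r h (point R)"
  show "R = reps"
  proof (rule ccontr)
    assume "R \<noteq> reps"
    then obtain b where b: "b \<in> reps" "b \<notin> R"
      using assms by blast
    have lt: "h b < r"
      using b(1) by (simp add: reps_def)
    have "key c \<le> key b" if "h c \<le> h b" for c
      using b(1) that key_less_iff[of b c] by (auto simp: reps_def not_less[symmetric])
    then have "0 < (\<Sum>c | h c \<le> h b. tiny R c)"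
      using sum_tiny_sign(2)[of b "{c. h c \<le> h b}" R] b(2) by simp
    moreover have "(\<Sum>c | h c \<le> h b. rough c) = h b"
      using rough_sum_rep[OF b(1)] rough_sum_restrict[of "{c. h c \<le> h b}"] by simp
    moreover have "(\<Sum>c | h c \<le> h b. point R $ c) \<le> real (h b)"
      using park lt h_pos[of b] unfolding parking_def by simp
    ultimately show False
      using lt h_o0 by (subst (asm) sum_point) auto
  qed
next
  assume R: "R = reps"
  show "parking r h (point R)"
    unfolding parking_def
  proof
    fix u assume "u \<in> {1..<r}"
    then have u: "u < r" by simp
    have "(\<Sum>c | h c \<le> u. tiny R c) \<le> 0"
    proof (cases "{c. h c \<le> u} = {}")
      case False
      obtain d where d: "d \<in> {c. h c \<le> u}" "\<And>c. c \<in> {c. h c \<le> u} \<Longrightarrow> key c \<le> key d"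
        using ex_max_key[OF False] by metis
      have "idx c \<le> idx d" if "h c = h d" for c
        using d(2)[of c] d(1) that by (simp add: key_def)
      then have "d \<in> reps"
        using d(1) u by (simp add: reps_def)
      then show ?thesis
        using sum_tiny_sign(1)[OF d] R by (simp add: less_imp_le)
    qed simp
    moreover have "real (\<Sum>c | h c \<le> u. rough c) \<le> real u"
      using rough_sum_le[OF u] by (simp only: of_nat_le_iff)
    moreover have "o0 \<notin> {c. h c \<le> u}"
      using u h_o0 by simp
    ultimately show "(\<Sum>c | h c \<le> u. point R $ c) \<le> real u"
      by (subst sum_point) simp_all
  qed
qed

lemma alternating_self: "alternating h \<noteq> 0"
proof -
  have "alternating h = (\<Sum>R\<in>Pow reps. if R = reps then (- 1) ^ card reps else 0)"
    unfolding alternating_def by (intro sum.cong) (auto simp: parking_self)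
  then show ?thesis
    by simp
qed

text \<open>Triangularity: every level of \<open>h\<close> is a level of \<open>g\<close>, and at
  levels of \<open>h\<close> below \<open>r\<close> the sublevel set of \<open>g\<close> is
  contained in that of \<open>h\<close>.\<close>

lemma alternating_order:
  assumes g: "g o0 = r" "\<And>b. 1 \<le> g b" "\<And>b. g b \<le> r" and nz: "alternating g \<noteq> 0"
  shows "range h \<subseteq> range g" "range h = range g \<Longrightarrow> h b \<le> g b"
proof -
  have *: "v \<in> range g" "g c \<le> v \<Longrightarrow> h c \<le> v" if v: "v \<in> range h" "v < r" for v c
  proof -
    obtain d where "d \<in> reps" "h d = v"
      using v ex_rep by (metis image_iff)
    then show "v \<in> range g" "g c \<le> v \<Longrightarrow> h c \<le> v"
      using alternating_neq_0[OF g(1,2) nz] by auto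
  qed
  show "range h \<subseteq> range g"
  proof
    fix v assume v: "v \<in> range h"
    show "v \<in> range g"
    proof (cases "v < r")
      case False
      then have "v = g o0"
        using v h_le g(1) by (force simp: not_less intro: antisym)
      then show ?thesis by simp
    qed (rule *(1)[OF v])
  qed
  show "h b \<le> g b" if "range h = range g"
  proof (cases "g b < r")
    case True
    then show ?thesis
      using *(2)[of "g b" b] that by auto
  next
    case False
    then show ?thesis
      using h_le[of b] by simp
  qed
qed

end

section \<open>Linear independence of plates\<close>

text \<open>Passing to the linear span raises the dimension by at most one, so the span is still a
  proper subspace.\<close>

lemma span_low_dim_negligible:
  fixes P :: "(real ^ 'n::finite) set"
  assumes "aff_dim P < int CARD('n) - 1"
  shows "negligible (span P)"
proof -
  have "int (dim (span P)) = int (dim (insert 0 P))"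
    by (metis dim_span span_insert_0)
  also have "\<dots> = aff_dim (insert 0 P)"
    by (rule aff_dim_zero[symmetric]) (simp add: hull_inc)
  also have "\<dots> \<le> aff_dim P + 1"
    by (simp add: aff_dim_insert)
  finally have "dim (span P) < DIM(real ^ 'n)"
    using assms by simp
  then show ?thesis
    by (rule negligible_lowdim)
qed

text \<open>The radial projection to the simplex turns a thin set into a null set of the whole space.\<close>

lemma thin_avoid:
  fixes x :: "real ^ 'n::finite"
  assumes r: "1 \<le> r" and A: "thin A"
    and x: "\<And>b. 0 < x $ b" "(\<Sum>b\<in>UNIV. x $ b) = real r"
    and off: "\<And>T t. T \<noteq> {} \<Longrightarrow> T \<noteq> UNIV \<Longrightarrow> (\<Sum>b\<in>T. x $ b) \<noteq> real t"
  shows "\<exists>v. v \<notin> A \<and> v \<in> dilated_simplex r \<and> (\<forall>T u. T \<noteq> {} \<longrightarrow> T \<noteq> UNIV \<longrightarrow> u \<le> r \<longrightarrow>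
    ((\<Sum>b\<in>T. v $ b) \<le> real u \<longleftrightarrow> (\<Sum>b\<in>T. x $ b) \<le> real u))"
proof -
  obtain F where F: "finite F" "A \<subseteq> \<Union>F" "\<And>P. P \<in> F \<Longrightarrow> aff_dim P < int CARD('n) - 1"
    using A unfolding thin_def by blast
  let ?I = "{T :: 'n set. T \<noteq> {} \<and> T \<noteq> UNIV} \<times> {..r}"
  let ?s = "\<lambda>T u. real u - (\<Sum>b\<in>T. x $ b)"
  \<comment> \<open>Positive vectors on the same side of every wall as \<open>x\<close>. The wall
    condition is made homogeneous by means of the coordinate sum, so that it survives rescaling to
    the simplex.\<close>
  define N where "N = (\<Inter>b\<in>UNIV. {v :: real ^ 'n. 0 < v $ b}) \<inter>
    (\<Inter>(T, u)\<in>?I. {v. 0 < ?s T u * (real u * (\<Sum>b\<in>UNIV. v $ b) - real r * (\<Sum>b\<in>T. v $ b))})"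
  have "open N"
    unfolding N_def
    by (intro open_Int open_INT) (auto intro!: open_Collect_less continuous_intros)
  moreover have "x \<in> N"
  proof -
    have "0 < ?s T u * (real u * real r - real r * (\<Sum>b\<in>T. x $ b))" if "T \<noteq> {}" "T \<noteq> UNIV" for T u
    proof -
      have "?s T u * (real u * real r - real r * (\<Sum>b\<in>T. x $ b)) = real r * (?s T u * ?s T u)"
        by (simp add: algebra_simps)
      moreover have "?s T u \<noteq> 0"
        using off[OF that, of u] by simp
      then have "0 < ?s T u * ?s T u"
        using not_real_square_gt_zero[of "?s T u"] by blast
      then have "0 < real r * (?s T u * ?s T u)"
        by (rule mult_pos_pos[rotated]) (use r in simp)
      ultimately show ?thesis
        by (simp only:)
    qed
    then show ?thesis
      using x by (auto simp: N_def)
  qed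
  ultimately have "\<not> negligible N"
    using open_not_negligible by blast
  moreover have "negligible (\<Union>P\<in>F. span P)"
    using F(1,3) by (intro negligible_Union) (auto intro: span_low_dim_negligible)
  ultimately obtain w where w: "w \<in> N" "w \<notin> (\<Union>P\<in>F. span P)"
    using negligible_subset by blast
  let ?W = "\<Sum>b\<in>UNIV. w $ b"
  have wpos: "0 < w $ b" for b
    using w(1) by (auto simp: N_def)
  then have W: "0 < ?W"
    by (intro sum_pos) auto
  define v where "v = (real r / ?W) *\<^sub>R w"
  have sumv: "(\<Sum>b\<in>T. v $ b) = real r * (\<Sum>b\<in>T. w $ b) / ?W" for T
    by (simp add: v_def sum_distrib_left sum_divide_distrib)
  show ?thesis
  proof (intro exI[of _ v] conjI allI impI)
    show "v \<notin> A"
    proof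
      assume "v \<in> A"
      then obtain P where P: "P \<in> F" "v \<in> P"
        using F(2) by blast
      have "w = (?W / real r) *\<^sub>R v"
        using W r by (simp add: v_def)
      then have "w \<in> span P"
        using P(2) by (metis span_base span_scale)
      with w(2) P(1) show False by blast
    qed
    have nonneg: "0 \<le> v $ b" for b
      using wpos[of b] W by (simp add: v_def)
    have sum: "(\<Sum>b\<in>UNIV. v $ b) = real r"
      using W by (simp add: sumv)
    moreover have "v $ b \<le> (\<Sum>b\<in>UNIV. v $ b)" for b
      using nonneg by (intro member_le_sum) auto
    ultimately show "v \<in> dilated_simplex r"
      using nonneg by (auto simp: dilated_simplex_def)
    fix T u assume T: "T \<noteq> {}" "T \<noteq> (UNIV :: 'n set)" "u \<le> r"
    then have "0 < ?s T u * (real u * ?W - real r * (\<Sum>b\<in>T. w $ b))"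
      using w(1) by (auto simp: N_def)
    moreover have "(\<Sum>b\<in>T. v $ b) \<le> real u \<longleftrightarrow> 0 \<le> real u * ?W - real r * (\<Sum>b\<in>T. w $ b)"
      using W by (simp add: sumv divide_le_eq)
    ultimately show "(\<Sum>b\<in>T. v $ b) \<le> real u \<longleftrightarrow> (\<Sum>b\<in>T. x $ b) \<le> real u"
      by (auto simp: zero_less_mult_iff)
  qed
qed

definition parking_class :: "nat \<Rightarrow> ('n \<Rightarrow> nat) \<Rightarrow> 'n::finite thin_fun" where
  "parking_class r h = thin_class (restrict_to_simplex r (\<lambda>x. if parking r h x then 1 else 0))"

text \<open>With \<open>h = r - f\<close>, the condition \<open>h o0 = r\<close> puts
  \<open>o0\<close> into the first lump.\<close>

definition based_maps :: "nat \<Rightarrow> 'n \<Rightarrow> ('n::finite \<Rightarrow> nat) set" where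
  "based_maps r o0 = {h. h o0 = r \<and> (\<forall>b. 1 \<le> h b \<and> h b \<le> r)}"

lemma based_maps_eq_PiE: "1 \<le> r \<Longrightarrow> based_maps r o0 = (\<Pi>\<^sub>E b\<in>UNIV. if b = o0 then {r} else {1..r})"
  by (auto simp: based_maps_def PiE_iff split: if_splits)

lemma finite_based_maps: "1 \<le> r \<Longrightarrow> finite (based_maps r o0)"
  by (simp add: based_maps_eq_PiE finite_PiE)

lemma card_based_maps:
  assumes "1 \<le> r"
  shows "card (based_maps r (o0 :: 'n::finite)) = r ^ (CARD('n) - 1)"
proof -
  have "card (based_maps r o0) = (\<Prod>b\<in>UNIV. if b = o0 then 1 else r)"
    unfolding based_maps_eq_PiE[OF assms] by (subst card_PiE) (auto intro!: prod.cong)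
  also have "\<dots> = (\<Prod>b\<in>- {o0}. if b = o0 then 1 else r)"
    by (rule prod.mono_neutral_right) auto
  also have "\<dots> = (\<Prod>b\<in>- {o0}. r)"
    by (rule prod.cong) auto
  also have "\<dots> = r ^ (CARD('n) - 1)"
    by (simp add: Compl_eq_Diff_UNIV card_Diff_subset)
  finally show ?thesis .
qed

text \<open>Lexicographic rank: the number of levels, with the sum of the values as tie-break. The
  factor exceeds every sum of values that are at most \<open>r\<close>.\<close>

definition level_rank :: "nat \<Rightarrow> ('n::finite \<Rightarrow> nat) \<Rightarrow> nat" where
  "level_rank r h = card (range h) * (CARD('n) * r + 1) + (\<Sum>b\<in>UNIV. h b)"

lemma level_rank_less:
  fixes g h :: "'n::finite \<Rightarrow> nat"
  assumes "\<And>b. h b \<le> r" "range h \<subseteq> range g" "range h = range g \<Longrightarrow> (\<And>b. h b \<le> g b)" "g \<noteq> h"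
  shows "level_rank r h < level_rank r g"
proof (cases "range h = range g")
  case True
  then have le: "h b \<le> g b" for b
    using assms(3) by blast
  moreover obtain b where "g b \<noteq> h b"
    using assms(4) by blast
  ultimately have "h b < g b"
    by (simp add: order_less_le)
  with le have "(\<Sum>b\<in>UNIV. h b) < (\<Sum>b\<in>UNIV. g b)"
    by (intro sum_strict_mono_ex1) auto
  then show ?thesis
    using True by (simp add: level_rank_def)
next
  case False
  then have "card (range h) < card (range g)"
    using assms(2) by (intro psubset_card_mono) auto
  then have "(card (range h) + 1) * (CARD('n) * r + 1) \<le> card (range g) * (CARD('n) * r + 1)"
    by (intro mult_le_mono1) simp
  moreover have "(\<Sum>b\<in>UNIV. h b) \<le> CARD('n) * r"
    using sum_bounded_above[of UNIV h r] assms(1) by simp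
  ultimately show ?thesis
    by (simp add: level_rank_def)
qed

text \<open>Take \<open>k\<close> of largest rank among the maps with nonzero coefficient and form
  the alternating sum at the test points of \<open>k\<close>. By \<open>alternating_order\<close>
  any other map seen by it ranks higher and has coefficient 0, so only the nonzero term of
  \<open>k\<close> is left.\<close>

lemma parking_classes_linearly_independent:
  fixes \<alpha> :: "('n::finite \<Rightarrow> nat) \<Rightarrow> complex"
  assumes r: "1 \<le> r"
    and zero: "(\<Sum>h\<in>based_maps r o0. scale_thin_fun (\<alpha> h) (parking_class r h)) = 0"
    and h: "h \<in> based_maps r o0"
  shows "\<alpha> h = 0"
proof (rule ccontr)
  assume "\<alpha> h \<noteq> 0"
  let ?H = "based_maps r o0" and ?p = "\<lambda>h x. if parking r h x then 1 else 0 :: complex"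
  let ?A = "{x. (\<Sum>h\<in>?H. \<alpha> h * restrict_to_simplex r (?p h) x) \<noteq> 0}"
  have "thin_class (\<lambda>x. \<Sum>h\<in>?H. \<alpha> h * restrict_to_simplex r (?p h) x) = thin_class (\<lambda>x. 0)"
    using zero unfolding thin_class_sum parking_class_def thin_class_0 .
  then have thin: "thin ?A"
    unfolding thin_fun.abs_eq_iff thin_eq_def .
  let ?S = "{h \<in> ?H. \<alpha> h \<noteq> 0}"
  have "finite ?S" "?S \<noteq> {}"
    using finite_subset[OF _ finite_based_maps[OF r, of o0]] h \<open>\<alpha> h \<noteq> 0\<close> by auto
  then have "Max (level_rank r ` ?S) \<in> level_rank r ` ?S"
    by (intro Max_in) auto
  then obtain k where k: "k \<in> ?S" "level_rank r k = Max (level_rank r ` ?S)"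
    by auto
  then have max: "level_rank r g \<le> level_rank r k" if "g \<in> ?S" for g
    using that \<open>finite ?S\<close> by simp
  obtain idx :: "'n \<Rightarrow> nat" where idx: "bij_betw idx UNIV {0..<CARD('n)}"
    using ex_bij_betw_finite_nat[of "UNIV :: 'n set"] by auto
  interpret test_points r k o0 idx "CARD('n)"
    using k(1) idx by unfold_locales (auto simp: based_maps_def bij_betw_def)
  \<comment> \<open>The relation holds only outside a thin set. Test points lie off all walls, so
    \<open>thin_avoid\<close> supplies a point outside that set which satisfies the same
    inequalities.\<close>
  have point_zero: "(\<Sum>g\<in>?H. \<alpha> g * ?p g (point R)) = 0" if R: "R \<subseteq> reps" for R
  proof -
    obtain v where v: "v \<notin> ?A" "v \<in> dilated_simplex r"
      "\<And>T u. T \<noteq> {} \<Longrightarrow> T \<noteq> UNIV \<Longrightarrow> u \<le> r \<Longrightarrow> (\<Sum>b\<in>T. v $ b) \<le> real u \<longleftrightarrow> (\<Sum>b\<in>T. point R $ b) \<le> real u"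
      using thin_avoid[OF r thin point_pos[OF R] sum_point_UNIV sum_point_not_nat] by auto
    have "parking r g v \<longleftrightarrow> parking r g (point R)" if g: "g \<in> ?H" for g
    proof -
      have "(\<Sum>b | g b \<le> u. v $ b) \<le> real u \<longleftrightarrow> (\<Sum>b | g b \<le> u. point R $ b) \<le> real u" if "u < r" for u
      proof (cases "{b. g b \<le> u} = {}")
        case False
        moreover have "o0 \<notin> {b. g b \<le> u}"
          using g that by (simp add: based_maps_def)
        ultimately show ?thesis
          using that by (intro v(3)) auto
      qed (simp only: sum.empty)
      then show ?thesis
        unfolding parking_def by simp
    qed
    then have "(\<Sum>g\<in>?H. \<alpha> g * ?p g (point R)) = (\<Sum>g\<in>?H. \<alpha> g * restrict_to_simplex r (?p g) v)"
      using v(2) by (intro sum.cong) (auto simp: restrict_to_simplex_def)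
    then show ?thesis
      using v(1) by simp
  qed
  have "(\<Sum>g\<in>?H. \<alpha> g * alternating g) = (\<Sum>R\<in>Pow reps. (- 1) ^ card R * (\<Sum>g\<in>?H. \<alpha> g * ?p g (point R)))"
    unfolding alternating_def sum_distrib_left by (subst sum.swap) (simp add: mult_ac)
  also have "\<dots> = 0"
    by (rule sum.neutral) (use point_zero in simp)
  also have "(\<Sum>g\<in>?H. \<alpha> g * alternating g) = (\<Sum>g\<in>?H. if g = k then \<alpha> k * alternating k else 0)"
  proof (rule sum.cong[OF refl])
    fix g assume g: "g \<in> ?H"
    have "\<alpha> g = 0 \<or> alternating g = 0" if neq: "g \<noteq> k"
    proof (rule ccontr)
      assume *: "\<not> ?thesis"
      have g': "g o0 = r" "\<And>b. 1 \<le> g b" "\<And>b. g b \<le> r"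
        using g by (auto simp: based_maps_def)
      have "level_rank r k < level_rank r g"
      proof (rule level_rank_less)
        show "k b \<le> r" for b
          by (rule h_le)
        show "range k \<subseteq> range g" "range k = range g \<Longrightarrow> k b \<le> g b" for b
          using alternating_order[of g, OF g'(1) g'(2) g'(3)] * by blast+
      qed (rule neq)
      moreover have "level_rank r g \<le> level_rank r k"
        using g * by (intro max) simp
      ultimately show False by simp
    qed
    then show "\<alpha> g * alternating g = (if g = k then \<alpha> k * alternating k else 0)"
      by auto
  qed
  also have "\<dots> = \<alpha> k * alternating k"
    using k(1) finite_based_maps[OF r, of o0] by simp
  finally show False
    using alternating_self k(1) by simp
qed

text \<open>Lumps are the fibres of \<open>f = r - h\<close> in increasing order of value, positions
  the gaps between values. As \<open>{b. f b < t}\<close> changes only at values of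
  \<open>f\<close>, the inequalities there imply those at all other \<open>t\<close>.\<close>

lemma parking_class_in_Pl:
  assumes "h \<in> based_maps r o0"
  shows "parking_class r h \<in> Pl r"
proof -
  define f where "f b = r - h b" for b
  have h: "h o0 = r" "\<And>b. 1 \<le> h b" "\<And>b. h b \<le> r"
    using assms by (auto simp: based_maps_def)
  have f_less: "f b < r" for b
    using h(2)[of b] h(3)[of b] by (simp add: f_def)
  define ps where "ps = sorted_list_of_set (range f)"
  define k where "k = length ps"
  \<comment> \<open>The closing \<open>r\<close> supplies the last gap; since \<open>o0\<close> has
    value 0, the gaps add up to \<open>r\<close>.\<close>
  define qs where "qs = ps @ [r]"
  define Ss where "Ss = map (\<lambda>p. {b. f b = p}) ps"
  define ss where "ss = map (\<lambda>i. qs ! Suc i - qs ! i) [0..<k]"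
  have ps: "set ps = range f" "sorted_wrt (<) ps"
    by (simp_all add: ps_def)
  have "sorted_wrt (<) qs"
    using ps f_less by (auto simp: qs_def sorted_wrt_append)
  then have qs_less: "qs ! i < qs ! j" if "i < j" "j \<le> k" for i j
    using that by (intro sorted_wrt_nth_less[of "(<)" qs]) (auto simp: qs_def k_def)
  have qs_less_iff: "qs ! i < qs ! j \<longleftrightarrow> i < j" if "i \<le> k" "j \<le> k" for i j
    using qs_less[of i j] qs_less[of j i] that by (metis linorder_neqE_nat order_less_asym)
  have qs_ps: "qs ! i = ps ! i" if "i < k" for i
    using that by (simp add: qs_def k_def nth_append)
  have qs_k: "qs ! k = r"
    by (simp add: qs_def k_def)
  have f_nth: "\<exists>i<k. f b = qs ! i" for b
  proof -
    have "f b \<in> set ps"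
      by (simp add: ps)
    then show ?thesis
      using qs_ps by (metis in_set_conv_nth k_def)
  qed
  have "f o0 = 0"
    by (simp add: f_def h)
  then have qs_0: "qs ! 0 = 0"
    using f_nth[of o0] qs_less_iff[of 0] by (metis gr_zeroI less_nat_zero_code less_imp_le zero_le)
  have sum_ss: "(\<Sum>i<j. ss ! i) = qs ! j" if "j \<le> k" for j
    using that
  proof (induction j)
    case (Suc j)
    then show ?case
      using qs_less[of j "Suc j"] by (simp add: ss_def)
  qed (simp add: qs_0)
  have sum_Ss: "(\<Sum>i<j. \<Sum>a\<in>Ss ! i. x $ a) = (\<Sum>b | f b < qs ! j. x $ b)" if "j \<le> k" for j and x :: "real ^ 'a"
    using that
  proof (induction j)
    case (Suc j)
    have "f b < qs ! Suc j \<longleftrightarrow> f b < qs ! j \<or> f b = qs ! j" for b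
    proof -
      obtain i where i: "i < k" "f b = qs ! i"
        using f_nth by blast
      then show ?thesis
        using Suc.prems qs_less_iff[of i j] qs_less_iff[of j i] qs_less_iff[of i "Suc j"]
        by (auto simp: less_Suc_eq)
    qed
    then have "{b. f b < qs ! Suc j} = {b. f b < qs ! j} \<union> {b. f b = qs ! j}"
      by auto
    moreover have "{b. f b < qs ! j} \<inter> {b. f b = qs ! j} = {}"
      by auto
    moreover have "Ss ! j = {b. f b = qs ! j}"
      using Suc.prems qs_ps[of j] by (simp add: Ss_def k_def)
    ultimately show ?case
      using Suc by (simp add: sum.union_disjoint)
  qed (simp add: qs_0)
  have len: "length Ss = k" "length ss = k"
    by (simp_all add: Ss_def ss_def k_def)
  have osp: "ordered_set_partition Ss"
    unfolding ordered_set_partition_def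
  proof
    have "inj_on (\<lambda>p. {b. f b = p}) (range f)"
      by (rule inj_onI) auto
    then show "distinct Ss"
      by (simp add: Ss_def distinct_map ps(1)) (simp add: ps_def)
    have "set Ss = range (\<lambda>b. {c. f c = f b})"
      by (auto simp: Ss_def ps(1))
    then show "partition_on UNIV (set Ss)"
      by (auto simp: partition_on_def disjoint_def)
  qed
  have "sum_list ss = (\<Sum>i<k. ss ! i)"
    by (simp add: sum_list_sum_nth len atLeast0LessThan)
  then have sum_list: "sum_list ss = r"
    by (simp add: sum_ss qs_k)
  have pos: "\<forall>s\<in>set ss. 0 < s"
    using qs_less by (auto simp: ss_def)
  have "parking r h x \<longleftrightarrow> x \<in> plate_set Ss ss" if x: "x \<in> dilated_simplex r" for x
  proof -
    have sumx: "(\<Sum>b\<in>UNIV. x $ b) = real r"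
      using x by (simp add: dilated_simplex_def)
    have plate: "x \<in> plate_set Ss ss \<longleftrightarrow> (\<forall>j\<in>{1..<k}. real (qs ! j) \<le> (\<Sum>b | f b < qs ! j. x $ b))"
    proof -
      have "{b. f b < qs ! k} = UNIV"
        using f_less by (simp add: qs_k)
      then show ?thesis
        using sum_Ss[of k x] sumx by (auto simp: plate_set_def len sum_ss sum_Ss qs_k)
    qed
    \<comment> \<open>The two index sets are complementary and the coordinates sum to
      \<open>r\<close>.\<close>
    have compl: "(\<Sum>b | h b \<le> r - t. x $ b) \<le> real (r - t) \<longleftrightarrow> real t \<le> (\<Sum>b | f b < t. x $ b)" if "t < r" for t
    proof -
      have "f b < t \<longleftrightarrow> \<not> h b \<le> r - t" for b
        using h(2,3)[of b] that by (auto simp: f_def)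
      then have "{b. f b < t} = - {b. h b \<le> r - t}"
        by auto
      moreover have "(\<Sum>b\<in>{b. h b \<le> r - t} \<union> - {b. h b \<le> r - t}. x $ b) =
          (\<Sum>b | h b \<le> r - t. x $ b) + (\<Sum>b\<in>- {b. h b \<le> r - t}. x $ b)"
        by (rule sum.union_disjoint) auto
      ultimately show ?thesis
        using sumx that by (auto simp: of_nat_diff Compl_partition)
    qed
    have park: "parking r h x \<longleftrightarrow> (\<forall>t\<in>{1..<r}. real t \<le> (\<Sum>b | f b < t. x $ b))"
    proof -
      have "parking r h x \<longleftrightarrow> (\<forall>t\<in>{1..<r}. (\<Sum>b | h b \<le> r - t. x $ b) \<le> real (r - t))"
      proof
        assume park: "parking r h x"
        show "\<forall>t\<in>{1..<r}. (\<Sum>b | h b \<le> r - t. x $ b) \<le> real (r - t)"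
        proof
          fix t assume "t \<in> {1..<r}"
          then have "r - t \<in> {1..<r}"
            by auto
          then show "(\<Sum>b | h b \<le> r - t. x $ b) \<le> real (r - t)"
            using park unfolding parking_def by blast
        qed
      next
        assume *: "\<forall>t\<in>{1..<r}. (\<Sum>b | h b \<le> r - t. x $ b) \<le> real (r - t)"
        show "parking r h x"
          unfolding parking_def
        proof
          fix u assume "u \<in> {1..<r}"
          then show "(\<Sum>b | h b \<le> u. x $ b) \<le> real u"
            using *[rule_format, of "r - u"] by auto
        qed
      qed
      then show ?thesis
        using compl by simp
    qed
    show ?thesis
    proof
      assume "parking r h x"
      moreover have "qs ! j \<in> {1..<r}" if "j \<in> {1..<k}" for j
        using that qs_less[of 0 j] qs_less[of j k] by (simp add: qs_0 qs_k Suc_le_eq)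
      ultimately show "x \<in> plate_set Ss ss"
        unfolding park plate by blast
    next
      assume P: "x \<in> plate_set Ss ss"
      show "parking r h x"
        unfolding park
      proof
        fix t assume t: "t \<in> {1..<r}"
        \<comment> \<open>Index of the next value of \<open>f\<close> at or after \<open>t\<close>,
          or of the closing \<open>r\<close>; no \<open>f b\<close> lies in between.\<close>
        define j where "j = (LEAST j. t \<le> qs ! j)"
        have ex: "t \<le> qs ! k"
          using t qs_k by simp
        have j: "t \<le> qs ! j" "j \<le> k"
          unfolding j_def using LeastI[of "\<lambda>j. t \<le> qs ! j", OF ex] Least_le[of "\<lambda>j. t \<le> qs ! j", OF ex] by auto
        have least: "qs ! i < t" if "i < j" for i
          using not_less_Least[of i "\<lambda>j. t \<le> qs ! j"] that unfolding j_def by simp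
        have "f b < t \<longleftrightarrow> f b < qs ! j" for b
        proof -
          obtain i where i: "i < k" "f b = qs ! i"
            using f_nth by blast
          then show ?thesis
            using j least[of i] qs_less_iff[of i j] by auto
        qed
        then have eq: "{b. f b < t} = {b. f b < qs ! j}"
          by simp
        show "real t \<le> (\<Sum>b | f b < t. x $ b)"
        proof (cases "j = k")
          case True
          then have "{b. f b < qs ! j} = UNIV"
            using f_less by (simp add: qs_k)
          then show ?thesis
            using sumx t unfolding eq by simp
        next
          case False
          moreover have "j \<noteq> 0"
            using j(1) t qs_0 by (intro notI) simp
          ultimately have "real (qs ! j) \<le> (\<Sum>b | f b < qs ! j. x $ b)"
            using P j(2) unfolding plate by simp
          then show ?thesis
            using j(1) unfolding eq by linarith
        qed
      qed
    qed
  qed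
  then have "restrict_to_simplex r (\<lambda>x. if parking r h x then 1 else 0) = restrict_to_simplex r (plate Ss ss)"
    by (auto simp: restrict_to_simplex_def plate_def fun_eq_iff indicator_def)
  then have "parking_class r h = thin_class (restrict_to_simplex r (plate Ss ss))"
    by (simp add: parking_class_def)
  then have "parking_class r h \<in> plate_classes r"
    using osp len pos sum_list unfolding plate_classes_def by auto
  then show ?thesis
    unfolding Pl_def by (rule thin_fun.span_base)
qed

section \<open>The character\<close>

lemma parking_classes_independent:
  assumes r: "1 \<le> r"
  shows "inj_on (parking_class r) (based_maps r o0)" "thin_fun.independent (parking_class r ` based_maps r (o0 :: 'n::finite))"
proof -
  let ?H = "based_maps r o0"
  note fin = finite_based_maps[OF r, of o0]
  show inj: "inj_on (parking_class r) ?H"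
  proof (rule inj_onI, rule ccontr)
    fix g h assume gh: "g \<in> ?H" "h \<in> ?H" "parking_class r g = parking_class r h" "g \<noteq> h"
    let ?\<alpha> = "\<lambda>k. if k = g then 1 else if k = h then - 1 else 0 :: complex"
    have "(\<Sum>k\<in>?H. scale_thin_fun (?\<alpha> k) (parking_class r k)) =
        (\<Sum>k\<in>{g, h}. scale_thin_fun (?\<alpha> k) (parking_class r k))"
      using gh fin by (intro sum.mono_neutral_right) auto
    also have "\<dots> = 0"
      using gh by simp
    finally have "?\<alpha> g = 0"
      by (rule parking_classes_linearly_independent[OF r _ gh(1)])
    then show False by simp
  qed
  show "thin_fun.independent (parking_class r ` ?H)"
  proof
    assume "thin_fun.dependent (parking_class r ` ?H)"
    then obtain u where u: "\<exists>v\<in>parking_class r ` ?H. u v \<noteq> 0"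
      "(\<Sum>v\<in>parking_class r ` ?H. scale_thin_fun (u v) v) = 0"
      using fin by (auto simp: thin_fun.dependent_finite)
    have "(\<Sum>h\<in>?H. scale_thin_fun (u (parking_class r h)) (parking_class r h)) = 0"
      using u(2) by (simp add: sum.reindex[OF inj])
    then show False
      using parking_classes_linearly_independent[OF r, where \<alpha> = "\<lambda>h. u (parking_class r h)" and ?o0.0 = o0] u(1) by auto
  qed
qed

text \<open>The independent \<open>?P\<close> lies in \<open>Pl r\<close>, hence in the span of
  \<open>?B\<close>, and has as many elements as there are indices. So no Fourier class is lost to
  coincidence or dependence, and \<open>?P\<close> spans as much as \<open>?B\<close>.\<close>

lemma fourier_basis:
  fixes r :: nat
  assumes r: "1 \<le> r"
  defines "Y \<equiv> fourier_index r :: ('n::finite \<Rightarrow> nat) set"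
  shows "inj_on (fourier_class r) Y" "thin_fun.independent (fourier_class r ` Y)"
    "thin_fun.span (fourier_class r ` Y) = Pl r"
proof -
  obtain o0 :: 'n where True by simp
  let ?P = "parking_class r ` based_maps r o0" and ?B = "fourier_class r ` Y"
  have card_P: "card ?P = card Y"
    using card_image[OF parking_classes_independent(1)[OF r, of o0]] card_based_maps[OF r, of o0]
      card_fourier_index[OF r, where 'n = 'n] by (simp add: Y_def)
  have fin_Y: "finite Y"
    unfolding Y_def fourier_index_def by (rule finite_subset[of _ "UNIV \<rightarrow>\<^sub>E {..<r}"]) (auto simp: finite_PiE)
  then have fin_B: "finite ?B" and card_B: "card ?B \<le> card Y"
    by (auto intro: card_image_le)
  have P_Pl: "?P \<subseteq> Pl r"
    using parking_class_in_Pl by blast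
  have Pl_B: "Pl r \<subseteq> thin_fun.span ?B"
    using Pl_subset_span_root_classes[OF r] root_classes_subset_span[OF r]
      thin_fun.span_minimal[OF _ thin_fun.subspace_span] unfolding Y_def by (metis subset_trans)
  \<comment> \<open>\<open>C\<close> spans an independent set of \<open>card Y\<close> elements, so
    it has at least that many and is all of \<open>?B\<close>.\<close>
  obtain C where C: "C \<subseteq> ?B" "thin_fun.independent C" "?B \<subseteq> thin_fun.span C"
    by (rule thin_fun.maximal_independent_subset)
  have "?P \<subseteq> thin_fun.span C"
    using P_Pl Pl_B thin_fun.span_minimal[OF C(3) thin_fun.subspace_span] by (meson subset_trans)
  then have "card Y \<le> card C"
    using thin_fun.independent_span_bound[OF finite_subset[OF C(1) fin_B] parking_classes_independent(2)[OF r, of o0]]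
    by (simp add: card_P)
  moreover have "card C \<le> card ?B"
    by (rule card_mono[OF fin_B C(1)])
  ultimately have "card C = card ?B" "card ?B = card Y"
    using card_B by simp_all
  then have "C = ?B" and inj: "inj_on (fourier_class r) Y"
    using card_subset_eq[OF fin_B C(1)] eq_card_imp_inj_on[OF fin_Y] by blast+
  then have ind: "thin_fun.independent ?B"
    using C(2) by simp
  have "b \<in> thin_fun.span ?P" if b: "b \<in> ?B" for b
  proof (rule ccontr)
    \<comment> \<open>Such a \<open>b\<close> would extend \<open>?P\<close> to an independent set
      larger than the spanning set \<open>?B\<close>.\<close>
    assume nb: "b \<notin> thin_fun.span ?P"
    then have "thin_fun.independent (insert b ?P)"
      using parking_classes_independent(2)[OF r, of o0] by (rule thin_fun.independent_insertI)
    moreover have "insert b ?P \<subseteq> thin_fun.span ?B"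
      using thin_fun.span_base[OF b] subset_trans[OF P_Pl Pl_B] by (rule insert_subsetI)
    ultimately have "card (insert b ?P) \<le> card ?B"
      using thin_fun.independent_span_bound[OF fin_B, of "insert b ?P"] by simp
    moreover have "b \<notin> ?P"
      using nb by (metis thin_fun.span_base)
    ultimately show False
      using finite_based_maps[OF r, of o0] \<open>card ?B = card Y\<close> card_P by simp
  qed
  then have "thin_fun.span ?B \<subseteq> thin_fun.span ?P"
    by (intro thin_fun.span_minimal thin_fun.subspace_span) auto
  also have "\<dots> \<subseteq> Pl r"
    using P_Pl unfolding Pl_def by (intro thin_fun.span_minimal thin_fun.subspace_span)
  finally show "thin_fun.span ?B = Pl r"
    using Pl_B by auto
  show "inj_on (fourier_class r) Y" "thin_fun.independent ?B"
    by fact+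
qed

lemma Pl_character_eq_card_fixed:
  fixes \<sigma> :: "'n::finite \<Rightarrow> 'n"
  assumes r: "1 \<le> r" and \<sigma>: "\<sigma> permutes UNIV"
  shows "Pl_character r \<sigma> = of_nat (card {y \<in> fourier_index r. y \<circ> inv \<sigma> = y})"
proof -
  let ?Y = "fourier_index r :: ('n \<Rightarrow> nat) set" and ?c = "fourier_class r :: _ \<Rightarrow> 'n thin_fun"
  note basis = fourier_basis[OF r, where 'n = 'n]
  have closed: "y \<circ> inv \<sigma> \<in> ?Y" if "y \<in> ?Y" for y
  proof -
    have "(\<Sum>b\<in>UNIV. (y \<circ> inv \<sigma>) b) = (\<Sum>b\<in>UNIV. y b)"
      using sum.permute[OF permutes_inv[OF \<sigma>], of y] by simp
    then show ?thesis
      using that by (auto simp: fourier_index_def PiE_iff)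
  qed
  have fin: "finite ?Y"
    unfolding fourier_index_def by (rule finite_subset[of _ "UNIV \<rightarrow>\<^sub>E {..<r}"]) (auto simp: finite_PiE)
  have "Pl_character r \<sigma> = (\<Sum>b\<in>?c ` ?Y. thin_fun.representation (?c ` ?Y) (act \<sigma> b) b)"
    by (rule Pl_character_eq[OF \<sigma> basis(2,3)])
  also have "\<dots> = (\<Sum>y\<in>?Y. thin_fun.representation (?c ` ?Y) (act \<sigma> (?c y)) (?c y))"
    by (simp add: sum.reindex[OF basis(1)])
  also have "\<dots> = (\<Sum>y\<in>?Y. if y \<circ> inv \<sigma> = y then 1 else 0)"
  proof (rule sum.cong[OF refl])
    fix y assume y: "y \<in> ?Y"
    have "thin_fun.representation (?c ` ?Y) (act \<sigma> (?c y)) (?c y) = (if ?c y = ?c (y \<circ> inv \<sigma>) then 1 else 0)"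
      unfolding act_fourier_class[OF \<sigma>] using closed[OF y]
      by (subst thin_fun.representation_basis[OF basis(2)]) auto
    then show "thin_fun.representation (?c ` ?Y) (act \<sigma> (?c y)) (?c y) = (if y \<circ> inv \<sigma> = y then 1 else 0)"
      using inj_onD[OF basis(1) _ y closed[OF y]] by auto
  qed
  also have "\<dots> = of_nat (card {y \<in> ?Y. y \<circ> inv \<sigma> = y})"
    using fin by (simp add: sum.If_cases Int_def)
  finally show ?thesis .
qed

lemma orbit_eq_iff:
  fixes \<sigma> :: "'n::finite \<Rightarrow> 'n"
  assumes \<sigma>: "\<sigma> permutes UNIV"
  shows "orbit \<sigma> x = orbit \<sigma> b \<longleftrightarrow> x \<in> orbit \<sigma> b"
proof -
  have self: "x \<in> orbit \<sigma> x" for x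
    using \<sigma> by (intro permutation_self_in_orbit) (auto simp: permutation_permutes)
  show ?thesis
  proof
    assume x: "x \<in> orbit \<sigma> b"
    then have "b \<in> orbit \<sigma> x"
      by (rule orbit_swap[OF self])
    with x show "orbit \<sigma> x = orbit \<sigma> b"
      using orbit_trans by fast
  qed (use self in blast)
qed

text \<open>A fixed map is constant on orbits, hence a map on the set of orbits; summing it over an
  orbit yields the factor \<open>card C\<close>.\<close>

lemma card_fixed_fourier_index:
  fixes \<sigma> :: "'n::finite \<Rightarrow> 'n"
  assumes \<sigma>: "\<sigma> permutes UNIV"
  shows "card {y \<in> fourier_index r. y \<circ> inv \<sigma> = y} =
    card {q \<in> range (orbit \<sigma>) \<rightarrow>\<^sub>E {..<r}. [(\<Sum>C\<in>range (orbit \<sigma>). card C * q C) = 1] (mod r)}"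
    (is "card ?F = card ?Q")
proof (rule bij_betw_same_card[symmetric])
  let ?O = "range (orbit \<sigma>)"
  let ?lift = "\<lambda>q b. q (orbit \<sigma> b)" and ?drop = "\<lambda>y. restrict (\<lambda>C. y (SOME b. b \<in> C)) ?O"
  have self: "b \<in> orbit \<sigma> b" for b
    using orbit_eq_iff[OF \<sigma>, of b b] by simp
  have fib: "{b. orbit \<sigma> b = C} = C" if "C \<in> ?O" for C
    using that orbit_eq_iff[OF \<sigma>] by auto
  have sum: "(\<Sum>b\<in>UNIV. q (orbit \<sigma> b)) = (\<Sum>C\<in>?O. card C * q C)" for q :: "'n set \<Rightarrow> nat"
  proof -
    have "(\<Sum>b\<in>UNIV. q (orbit \<sigma> b)) = (\<Sum>C\<in>?O. \<Sum>b | b \<in> UNIV \<and> orbit \<sigma> b = C. q (orbit \<sigma> b))"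
      by (rule sum.image_gen) simp
    also have "\<dots> = (\<Sum>C\<in>?O. card C * q C)"
    proof (rule sum.cong[OF refl])
      fix C assume C: "C \<in> ?O"
      have "(\<Sum>b | b \<in> UNIV \<and> orbit \<sigma> b = C. q (orbit \<sigma> b)) = (\<Sum>b | orbit \<sigma> b = C. q C)"
        by (rule sum.cong) auto
      then show "(\<Sum>b | b \<in> UNIV \<and> orbit \<sigma> b = C. q (orbit \<sigma> b)) = card C * q C"
        by (simp add: fib[OF C])
    qed
    finally show ?thesis .
  qed
  have const: "y x = y b" if fixed: "y \<circ> inv \<sigma> = y" and x: "x \<in> orbit \<sigma> b" for y :: "'n \<Rightarrow> nat" and x b
  proof -
    have "y (\<sigma> c) = y c" for c
      using fun_cong[OF fixed, of "\<sigma> c"] permutes_inverses(2)[OF \<sigma>] by simp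
    with x show ?thesis
      by (induction rule: orbit.induct) auto
  qed
  have some: "(SOME x. x \<in> orbit \<sigma> b) \<in> orbit \<sigma> b" for b
    by (rule someI[of "\<lambda>x. x \<in> orbit \<sigma> b", OF self])
  have lift_drop: "?lift (?drop y) = y" if "y \<circ> inv \<sigma> = y" for y :: "'n \<Rightarrow> nat"
    using const[OF that some] by (simp add: fun_eq_iff)
  have drop_lift: "?drop (?lift q) = q" if "q \<in> ?O \<rightarrow>\<^sub>E {..<r}" for q :: "'n set \<Rightarrow> nat"
  proof
    fix C
    show "?drop (?lift q) C = q C"
    proof (cases "C \<in> ?O")
      case True
      then obtain b where "C = orbit \<sigma> b" by blast
      moreover have "orbit \<sigma> (SOME x. x \<in> orbit \<sigma> b) = orbit \<sigma> b"
        using orbit_eq_iff[OF \<sigma>] some by blast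
      ultimately show ?thesis
        by simp
    next
      case False
      then show ?thesis
        using that by (auto simp: PiE_iff extensional_def)
    qed
  qed
  show "bij_betw ?lift ?Q ?F"
  proof (rule bij_betwI[where g = ?drop])
    show "?lift \<in> ?Q \<rightarrow> ?F"
    proof
      fix q assume q: "q \<in> ?Q"
      have "orbit \<sigma> (inv \<sigma> b) = orbit \<sigma> b" for b
        using orbit_eq_iff[OF \<sigma>, of b "inv \<sigma> b"] orbit.base[of \<sigma> "inv \<sigma> b"] permutes_inverses(1)[OF \<sigma>] by simp
      then show "?lift q \<in> ?F"
        using q by (auto simp: fourier_index_def sum PiE_iff fun_eq_iff)
    qed
    show "?drop \<in> ?F \<rightarrow> ?Q"
    proof
      fix y assume y: "y \<in> ?F"
      then have "(\<Sum>C\<in>?O. card C * ?drop y C) = (\<Sum>b\<in>UNIV. y b)"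
        using sum[of "?drop y"] fun_cong[OF lift_drop[of y]] by simp
      then show "?drop y \<in> ?Q"
        using y by (auto simp: fourier_index_def PiE_iff)
    qed
    show "?drop (?lift q) = q" if "q \<in> ?Q" for q
      using that by (intro drop_lift) simp
    show "?lift (?drop y) = y" if "y \<in> ?F" for y
      using that by (intro lift_drop) simp
  qed
qed

theorem theorem10:
  fixes r :: nat and \<sigma> :: "'n::finite \<Rightarrow> 'n" and ls :: "nat list"
  assumes "r \<ge> 1"
    and "\<sigma> permutes UNIV"
    and "mset ls = cycle_lengths \<sigma>"
  shows "Pl_character r \<sigma> =
    (if Gcd (insert r (set ls)) = 1 then of_nat r ^ (length ls - 1) else 0)"
proof -
  let ?O = "range (orbit \<sigma>)"
  have "set_mset (mset ls) = card ` ?O"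
    unfolding assms(3) cycle_lengths_def by simp
  then have set: "set ls = card ` ?O"
    by simp
  have "size (mset ls) = card ?O"
    unfolding assms(3) cycle_lengths_def by simp
  then have length: "length ls = card ?O"
    by simp
  have "card {y \<in> fourier_index r. y \<circ> inv \<sigma> = y} = (if Gcd (insert r (card ` ?O)) = 1 then r ^ (card ?O - 1) else 0)"
    unfolding card_fixed_fourier_index[OF assms(2)]
    by (rule card_linear_cong_1[OF assms(1)]) auto
  then show ?thesis
    unfolding Pl_character_eq_card_fixed[OF assms(1,2)] set length by simp
qed

end
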